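(* Let $f\in C^2(\mathbb R)$ satisfy $f''>0$ on $\mathbb R$ and $f(z)\to\infty$ as $|z|\to\infty$; let $u_{\mathrm s}$ be its unique minimizer, and assume $f(u_{\mathrm s})=0$. Let $u_\ell,u_r\in\mathbb R$ satisfy $u_r<u_{\mathrm s}<u_\ell$, and set $$\mathcal A:=\{u\in H^1(0,1):u(0)=u_\ell,\ u(1)=u_r\},\qquad J^0(u):=\frac12\int_0^1|\partial_x f(u(x))|^2\,dx\quad(u\in\mathcal A),$$ $$s:=f(u_\ell)+f(u_r),\qquad x^\dagger:=\frac{f(u_\ell)}{s}.$$ Then: (i) $\inf_{u\in\mathcal A}J^0(u)=\tfrac12s^2$. Every minimizing sequence $\{u_n\}\subset\mathcal A$ of $J^0$ converges uniformly on $[0,1]$ to $$u^\dagger(x):=\begin{cases} f_+^{-1}\bigl(s|x-x^\dagger|\bigr), & x\le x^\dagger,\\ f_-^{-1}\bigl(s|x-x^\dagger|\bigr), & x>x^\dagger.\end{cases}$$ Moreover $\partial_x f(u_n)\to r^\dagger:=s\operatorname{sign}(x-x^\dagger)$ strongly in $L^2(0,1)$, with $u^\dagger\in C^0([0,1])\setminus H^1(0,1)$ and $r^\dagger\in L^2(0,1)\setminus H^1(0,1)$, and $\|u_n'\|_{L^2(0,1)}\to\infty$. In particular, the infimum is not attained in $\mathcal A$. (ii) Let $\{u_\theta:\theta\in\mathbb R^N\}\subset\mathcal A$ be a parameterized family, with $\theta\mapsto u_\theta$ of class $C^1$ (into the affine space $\mathcal A$, modelled on $H^1_0(0,1)$),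 such that $$\sup_{|\theta|\le R}\|u_\theta'\|_{L^2(0,1)}<\infty\qquad\text{for every }R>0.$$ If $\{\theta_n\}\subset\mathbb R^N$ satisfies $J^0(u_{\theta_n})\to\inf_{u\in\mathcal A}J^0(u)$, then $|\theta_n|\to\infty$.
   Context: $f_+^{-1}:[0,\infty)\to[u_{\mathrm s},\infty)$ and $f_-^{-1}:[0,\infty)\to(-\infty,u_{\mathrm s}]$ denote the inverses of the restrictions of $f$ to $[u_{\mathrm s},\infty)$ and to $(-\infty,u_{\mathrm s}]$, respectively. For $u\in H^1(0,1)$ one has $\partial_xf(u)=f'(u)u_x\in L^2(0,1)$, so $J^0(u)$ is finite. Elements of $H^1(0,1)$ are identified with their continuous representatives. A minimizing sequence is a sequence $\{u_n\}\subset\mathcal A$ with $J^0(u_n)\to\inf_{\mathcal A}J^0$. *)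

theory Defs
  imports "HOL-Analysis.Analysis"
begin

text \<open>
  Functions on the unit interval are total functions on the reals whose values outside
  \<open>[0,1]\<close> are irrelevant: all integrals below are over \<open>(0,1)\<close>, and all pointwise conditions are
  restricted to \<open>[0,1]\<close>.
\<close>

abbreviation unit_leb :: "real measure" where
  "unit_leb \<equiv> lebesgue_on {0<..<1}"

definition L2 :: "(real \<Rightarrow> real) set" where
  "L2 = {g \<in> borel_measurable unit_leb. integrable unit_leb (\<lambda>x. (g x)\<^sup>2)}"

definition l2norm :: "(real \<Rightarrow> real) \<Rightarrow> real" where
  "l2norm g = sqrt (LINT x|unit_leb. (g x)\<^sup>2)"

definition test_functions :: "(real \<Rightarrow> real) set" where
  "test_functions =
     {\<phi>. (\<forall>k x. ((deriv ^^ k) \<phi>) field_differentiable (at x)) \<and>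
         compact (closure {x. \<phi> x \<noteq> 0}) \<and> closure {x. \<phi> x \<noteq> 0} \<subseteq> {0<..<1}}"

definition has_weak_deriv :: "(real \<Rightarrow> real) \<Rightarrow> (real \<Rightarrow> real) \<Rightarrow> bool" where
  "has_weak_deriv u g \<longleftrightarrow>
     (\<forall>\<phi>\<in>test_functions.
        (LINT x|unit_leb. u x * deriv \<phi> x) = - (LINT x|unit_leb. g x * \<phi> x))"

text \<open>
  Membership in \<open>H1\<close> depends only on the almost-everywhere class of \<open>u\<close> on \<open>(0,1)\<close>. In particular
  \<open>u \<notin> H1\<close> says that no representative of \<open>u\<close> is a Sobolev function. The choice of the continuous
  representative is made separately, in \<open>H1_cont\<close>.
\<close>

definition H1 :: "(real \<Rightarrow> real) set" where
  "H1 = {u \<in> L2. \<exists>g\<in>L2. has_weak_deriv u g}"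

definition H1_cont :: "(real \<Rightarrow> real) set" where
  "H1_cont = {u \<in> H1. continuous_on {0..1} u}"

text \<open>A representative of the weak derivative, which is unique up to null sets; meaningful on \<open>H1\<close>.\<close>

definition weak_deriv :: "(real \<Rightarrow> real) \<Rightarrow> (real \<Rightarrow> real)" where
  "weak_deriv u = (SOME g. g \<in> L2 \<and> has_weak_deriv u g)"

definition h1norm :: "(real \<Rightarrow> real) \<Rightarrow> real" where
  "h1norm u = sqrt ((l2norm u)\<^sup>2 + (l2norm (weak_deriv u))\<^sup>2)"

definition H10 :: "(real \<Rightarrow> real) set" where
  "H10 = {v \<in> H1_cont. v 0 = 0 \<and> v 1 = 0}"

definition admissible :: "real \<Rightarrow> real \<Rightarrow> (real \<Rightarrow> real) set" where
  "admissible ul ur = {u \<in> H1_cont. u 0 = ul \<and> u 1 = ur}"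

text \<open>
  The integrand is the weak derivative of the composition. For \<open>f\<close> of class \<open>C\<^sup>1\<close> and \<open>u \<in> H1_cont\<close>
  the composition is in \<open>H1\<close> by the chain rule, so that the integral is finite.
\<close>

definition J0 :: "(real \<Rightarrow> real) \<Rightarrow> (real \<Rightarrow> real) \<Rightarrow> real" where
  "J0 f u = 1 / 2 * (LINT x|unit_leb. \<bar>weak_deriv (\<lambda>y. f (u y)) x\<bar>\<^sup>2)"

definition minimizing_seq ::
    "(real \<Rightarrow> real) \<Rightarrow> (real \<Rightarrow> real) set \<Rightarrow> (nat \<Rightarrow> real \<Rightarrow> real) \<Rightarrow> bool" where
  "minimizing_seq f A U \<longleftrightarrow>
     (\<forall>n. U n \<in> A) \<and> (\<lambda>n. J0 f (U n)) \<longlonglongrightarrow> (INF u\<in>A. J0 f u)"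

text \<open>
  Continuous Frechet differentiability with respect to the \<open>H\<^sup>1\<close> norm: \<open>D \<theta>\<close> is the derivative at
  \<open>\<theta>\<close>, a linear map into \<open>H10\<close> (automatically bounded, as its domain is finite-dimensional), and
  the last clause is continuity of \<open>D\<close> in the operator norm.
\<close>

definition C1_family :: "('p::euclidean_space \<Rightarrow> real \<Rightarrow> real) \<Rightarrow> bool" where
  "C1_family u \<longleftrightarrow>
     (\<exists>D :: 'p \<Rightarrow> 'p \<Rightarrow> real \<Rightarrow> real.
        (\<forall>\<theta> h. D \<theta> h \<in> H10) \<and>
        (\<forall>\<theta>. \<forall>x\<in>{0..1}. linear (\<lambda>h. D \<theta> h x)) \<and>
        (\<forall>\<theta>. ((\<lambda>h. h1norm (\<lambda>x. u (\<theta> + h) x - u \<theta> x - D \<theta> h x) / norm h) \<longlongrightarrow> 0) (at 0)) \<and>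
        (\<forall>\<theta>. \<forall>\<epsilon>>0. \<exists>\<delta>>0. \<forall>\<eta>. norm (\<eta> - \<theta>) < \<delta> \<longrightarrow>
           (\<forall>h. h1norm (\<lambda>x. D \<eta> h x - D \<theta> h x) \<le> \<epsilon> * norm h)))"

end

theory Submission
  imports Defs
begin

text \<open>
  Let \<open>p = f \<circ> u\<close> with weak derivative \<open>r\<close>, and let \<open>c\<close> be a point where \<open>u\<close> crosses the minimizer.
  Expanding the square and using the boundary values of \<open>p\<close> gives
  \<open>\<integral>(r - s sgn(x - c))\<^sup>2 = 2 J0 u - s\<^sup>2\<close>. This is the lower bound, and along a minimizing sequence
  it forces \<open>r\<close> to approach \<open>s sgn(x - c)\<close>; the boundary value \<open>p 0\<close> then forces \<open>c\<close> to approach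
  \<open>xdag\<close>. Hence \<open>f \<circ> u\<close> converges uniformly to \<open>s \<bar>x - xdag\<bar>\<close>, and \<open>u\<close> itself converges because it
  cannot leave its branch of \<open>f\<close> where \<open>f \<circ> u\<close> is bounded away from zero. The limit behaves like a
  square root at \<open>xdag\<close>, so that its difference quotients over dyadic intervals have infinite energy;
  this makes the derivatives of every approximating sequence blow up. The bound is approached by
  choosing \<open>u\<close> such that a strictly monotone perturbation of the signed flux is affine.
\<close>

section \<open>Primitives of integrable functions\<close>

text \<open>Everything about an element of \<open>H1_cont\<close> is read off from
  \<open>u x = u 0 + integral {0..x} g\<close>, valid for every weak derivative \<open>g\<close>;
  this matters because \<open>weak_deriv\<close> is an arbitrary choice. The chain rule and
  integration by parts then become statements about increments over short intervals, with no
  pointwise differentiability of \<open>u\<close>. Obtaining the representation from the weak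
  formulation is what requires explicit smooth test functions.

  The constant \<open>s\<close> is the least total variation of the flux, which has to descend from
  \<open>f ul\<close> to 0 and climb to \<open>f ur\<close>. The crossing point \<open>c\<close>
  varies with \<open>u\<close> and need not be unique; only \<open>f (u c) = 0\<close> enters.

  The blow-up uses no weak compactness: finitely many difference quotients bound the energy from
  below and pass to pointwise limits. Constant sequences are allowed, so the same argument shows
  that \<open>udag\<close> is not in \<open>H1\<close> and that the infimum is not attained.\<close>

lemma absolutely_integrable_continuous_mult:
  fixes g h :: "real \<Rightarrow> real"
  assumes "g absolutely_integrable_on {a..b}" "continuous_on {a..b} h"
  shows "(\<lambda>x. h x * g x) absolutely_integrable_on {a..b}"
proof (rule absolutely_integrable_bounded_measurable_product_real)
  show "h \<in> borel_measurable (lebesgue_on {a..b})"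
    by (rule continuous_imp_measurable_on_sets_lebesgue[OF assms(2)]) simp
  show "bounded (h ` {a..b})"
    using assms(2) compact_continuous_image compact_imp_bounded by blast
qed (use assms in auto)

text \<open>Local errors that are at most \<open>e\<close> times an additive quantity sum over a
  fine partition to at most \<open>e\<close> times its total, and \<open>e\<close> is arbitrary.
  This passage from local to global stands in for differentiation almost everywhere.\<close>

lemma increment_eq_integral:
  fixes P k q :: "real \<Rightarrow> real"
  assumes ab: "a \<le> b" and k: "k integrable_on {a..b}" and q: "q integrable_on {a..b}"
    and loc: "\<And>e. e > 0 \<Longrightarrow> \<exists>d>0. \<forall>x y. a \<le> x \<longrightarrow> x \<le> y \<longrightarrow> y \<le> b \<longrightarrow> y - x < d \<longrightarrow>
      \<bar>P y - P x - integral {x..y} k\<bar> \<le> e * integral {x..y} q"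
  shows "P b - P a = integral {a..b} k"
proof -
  have small: "\<bar>P b - P a - integral {a..b} k\<bar> \<le> e * integral {a..b} q" if e: "e > 0" for e
  proof -
    obtain d where d: "d > 0" and D: "\<And>x y. a \<le> x \<Longrightarrow> x \<le> y \<Longrightarrow> y \<le> b \<Longrightarrow> y - x < d \<Longrightarrow>
      \<bar>P y - P x - integral {x..y} k\<bar> \<le> e * integral {x..y} q"
      using loc[OF e] by blast
    obtain n :: nat where n: "(b - a) / d < real n" using reals_Archimedean2 by blast
    have npos: "real n > 0" using n ab d by (smt (verit) divide_nonneg_pos)
    define t where "t i = a + real i * ((b - a) / real n)" for i
    have step: "t (Suc i) - t i = (b - a) / real n" for i unfolding t_def of_nat_Suc distrib_right by simp
    have h: "0 \<le> (b - a) / real n" "(b - a) / real n < d"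
      using ab npos n d by (auto simp: field_simps)
    have tb: "t i \<le> b" if "i \<le> n" for i
    proof -
      have "real i * ((b - a) / real n) \<le> real n * ((b - a) / real n)"
        using that h by (intro mult_right_mono) auto
      then show ?thesis using npos by (simp add: t_def)
    qed
    have ta: "a \<le> t i" for i unfolding t_def using mult_nonneg_nonneg[OF of_nat_0_le_iff h(1)] by simp
    have "i \<le> n \<Longrightarrow> \<bar>P (t i) - P a - integral {a..t i} k\<bar> \<le> e * integral {a..t i} q" for i
    proof (induction i)
      case 0 then show ?case by (simp add: t_def)
    next
      case (Suc i)
      have lt: "t i \<le> t (Suc i)" using step[of i] h by linarith
      have sub: "{a..t (Suc i)} \<subseteq> {a..b}" using tb[OF Suc.prems] by auto
      have "integral {a..t i} k + integral {t i..t (Suc i)} k = integral {a..t (Suc i)} k"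
        using ta lt k sub by (intro Henstock_Kurzweil_Integration.integral_combine integrable_on_subinterval[OF k]) auto
      moreover have "integral {a..t i} q + integral {t i..t (Suc i)} q = integral {a..t (Suc i)} q"
        using ta lt sub by (intro Henstock_Kurzweil_Integration.integral_combine integrable_on_subinterval[OF q]) auto
      moreover have "\<bar>P (t (Suc i)) - P (t i) - integral {t i..t (Suc i)} k\<bar> \<le> e * integral {t i..t (Suc i)} q"
        using D[OF ta lt tb[OF Suc.prems]] step[of i] h by simp
      ultimately show ?case using Suc by (smt (verit) Suc_leD distrib_left)
    qed
    from this[of n] show ?thesis using npos by (simp add: t_def)
  qed
  have "\<bar>P b - P a - integral {a..b} k\<bar> \<le> 0"
  proof (rule field_le_epsilon)
    fix e :: real assume e: "e > 0"
    \<comment> \<open>The added 1 keeps the denominator positive when the integral of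
      \<open>q\<close> vanishes.\<close>
    define c where "c = e / (\<bar>integral {a..b} q\<bar> + 1)"
    have "c > 0" using e by (simp add: c_def add_nonneg_pos)
    moreover have "c * integral {a..b} q \<le> e"
    proof -
      have "c * integral {a..b} q \<le> c * (\<bar>integral {a..b} q\<bar> + 1)"
        using \<open>c > 0\<close> by (intro mult_left_mono) auto
      also have "\<dots> = e" by (simp add: c_def)
      finally show ?thesis .
    qed
    ultimately show "\<bar>P b - P a - integral {a..b} k\<bar> \<le> 0 + e" using small[of c] by linarith
  qed
  then show ?thesis by simp
qed

lemma primitive_increment:
  fixes U g :: "real \<Rightarrow> real"
  assumes "g integrable_on {a..b}" "\<And>x. x \<in> {a..b} \<Longrightarrow> U x = U a + integral {a..x} g"
    and "a \<le> x" "x \<le> y" "y \<le> b"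
  shows "U y - U x = integral {x..y} g"
proof -
  have "integral {a..x} g + integral {x..y} g = integral {a..y} g"
    using assms by (intro Henstock_Kurzweil_Integration.integral_combine integrable_on_subinterval[OF assms(1)]) auto
  then show ?thesis using assms(2)[of x] assms(2)[of y] assms(3-5) by simp
qed

lemma primitive_continuous:
  fixes U g :: "real \<Rightarrow> real"
  assumes "g integrable_on {a..b}" "\<And>x. x \<in> {a..b} \<Longrightarrow> U x = U a + integral {a..x} g"
  shows "continuous_on {a..b} U"
proof -
  have "continuous_on {a..b} (\<lambda>x. U a + integral {a..x} g)"
    by (intro continuous_intros indefinite_integral_continuous_1 assms)
  then show ?thesis using assms(2) by (metis (no_types, lifting) continuous_on_cong)
qed

lemma integral_abs_bound_mult:
  fixes g h :: "real \<Rightarrow> real"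
  assumes "g absolutely_integrable_on {x..y}" "(\<lambda>t. h t * g t) integrable_on {x..y}"
    and "\<And>t. t \<in> {x..y} \<Longrightarrow> \<bar>h t\<bar> \<le> e"
  shows "\<bar>integral {x..y} (\<lambda>t. h t * g t)\<bar> \<le> e * integral {x..y} (\<lambda>t. \<bar>g t\<bar>)"
proof -
  have "norm (integral {x..y} (\<lambda>t. h t * g t)) \<le> integral {x..y} (\<lambda>t. e * \<bar>g t\<bar>)"
  proof (rule integral_norm_bound_integral)
    have "(\<lambda>t. \<bar>g t\<bar>) integrable_on {x..y}"
      using assms(1) by (simp add: absolutely_integrable_on_def)
    then show "(\<lambda>t. e * \<bar>g t\<bar>) integrable_on {x..y}"
      by (rule integrable_on_mult_right)
    show "norm (h t * g t) \<le> e * \<bar>g t\<bar>" if "t \<in> {x..y}" for t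
      using assms(3)[OF that] by (simp add: abs_mult mult_right_mono)
  qed (use assms in auto)
  then show ?thesis by simp
qed

text \<open>Over a short interval the mean value theorem replaces the increment of \<open>f\<close>
  by \<open>f' \<xi>\<close> times the increment of \<open>U\<close>. Uniform continuity makes
  \<open>f' \<xi>\<close> differ from \<open>f' (U t)\<close> by at most \<open>e\<close>, so the
  error is controlled by \<open>e\<close> times the integral of \<open>\<bar>g\<bar>\<close>, which
  is additive.\<close>

lemma chain_rule_primitive:
  fixes f f' U g :: "real \<Rightarrow> real"
  assumes ab: "a \<le> b" and g: "g absolutely_integrable_on {a..b}"
    and U: "\<And>x. x \<in> {a..b} \<Longrightarrow> U x = U a + integral {a..x} g"
    and f: "\<And>z. (f has_real_derivative f' z) (at z)" and f': "continuous_on UNIV f'"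
  shows "f (U b) - f (U a) = integral {a..b} (\<lambda>t. f' (U t) * g t)"
proof -
  have gi: "g integrable_on {a..b}" using g by (auto simp: absolutely_integrable_on_def)
  have cU: "continuous_on {a..b} U" by (rule primitive_continuous[OF gi U])
  have cf'U: "continuous_on {a..b} (\<lambda>t. f' (U t))"
    by (rule continuous_on_compose2[OF f' cU]) auto
  have k: "(\<lambda>t. f' (U t) * g t) absolutely_integrable_on {a..b}"
    by (rule absolutely_integrable_continuous_mult[OF g cf'U])
  show ?thesis
  proof (rule increment_eq_integral[OF ab, where q = "\<lambda>t. \<bar>g t\<bar>" and P = "\<lambda>t. f (U t)"])
    show "(\<lambda>t. f' (U t) * g t) integrable_on {a..b}" "(\<lambda>t. \<bar>g t\<bar>) integrable_on {a..b}"
      using g k by (auto simp: absolutely_integrable_on_def)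
    fix e :: real assume e: "e > 0"
    have "bounded (U ` {a..b})"
      using cU compact_continuous_image compact_imp_bounded by blast
    then obtain M where M: "\<And>t. t \<in> {a..b} \<Longrightarrow> \<bar>U t\<bar> \<le> M" unfolding bounded_real by blast
    have "uniformly_continuous_on {-M..M} f'"
      by (rule compact_uniformly_continuous[OF continuous_on_subset[OF f']]) auto
    then obtain d1 where d1: "d1 > 0" and D1: "\<And>z w. z \<in> {-M..M} \<Longrightarrow> w \<in> {-M..M} \<Longrightarrow> \<bar>w - z\<bar> < d1 \<Longrightarrow> \<bar>f' w - f' z\<bar> < e"
      using e by (auto simp: uniformly_continuous_on_def dist_real_def)
    have "uniformly_continuous_on {a..b} U"
      by (rule compact_uniformly_continuous[OF cU]) auto
    then obtain d where d: "d > 0" and D: "\<And>s t. s \<in> {a..b} \<Longrightarrow> t \<in> {a..b} \<Longrightarrow> \<bar>t - s\<bar> < d \<Longrightarrow> \<bar>U t - U s\<bar> < d1"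
      using d1 by (auto simp: uniformly_continuous_on_def dist_real_def)
    have "\<bar>f (U y) - f (U x) - integral {x..y} (\<lambda>t. f' (U t) * g t)\<bar> \<le> e * integral {x..y} (\<lambda>t. \<bar>g t\<bar>)"
      if xy: "a \<le> x" "x \<le> y" "y \<le> b" "y - x < d" for x y
    proof -
      have "\<exists>\<xi>. f (U y) - f (U x) = f' \<xi> * (U y - U x) \<and> min (U x) (U y) \<le> \<xi> \<and> \<xi> \<le> max (U x) (U y)"
      proof (cases "U x" "U y" rule: linorder_cases)
        case less
        then obtain \<xi> where "\<xi> > U x" "\<xi> < U y" "f (U y) - f (U x) = (U y - U x) * f' \<xi>"
          using MVT2[of "U x" "U y" f f'] f by blast
        then show ?thesis by (intro exI[of _ \<xi>]) auto
      next
        case equal then show ?thesis by auto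
      next
        case greater
        then obtain \<xi> where "\<xi> > U y" "\<xi> < U x" "f (U x) - f (U y) = (U x - U y) * f' \<xi>"
          using MVT2[of "U y" "U x" f f'] f by blast
        then show ?thesis by (intro exI[of _ \<xi>]) (auto simp: algebra_simps)
      qed
      then obtain \<xi> where xi: "f (U y) - f (U x) = f' \<xi> * (U y - U x)" "min (U x) (U y) \<le> \<xi>" "\<xi> \<le> max (U x) (U y)"
        by blast
      have gxy: "g absolutely_integrable_on {x..y}"
        using absolutely_integrable_on_subinterval[OF g] xy by auto
      have kxy: "(\<lambda>t. f' (U t) * g t) integrable_on {x..y}"
        using absolutely_integrable_on_subinterval[OF k, of x y] xy by (auto simp: absolutely_integrable_on_def)
      have gi': "g integrable_on {x..y}" using gxy by (auto simp: absolutely_integrable_on_def)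
      have "U y - U x = integral {x..y} g" using primitive_increment[OF gi U] xy by blast
      then have eq: "f (U y) - f (U x) - integral {x..y} (\<lambda>t. f' (U t) * g t) = integral {x..y} (\<lambda>t. (f' \<xi> - f' (U t)) * g t)"
        unfolding left_diff_distrib
        by (subst Henstock_Kurzweil_Integration.integral_diff)
          (use kxy gi' xi(1) in \<open>auto intro: integrable_on_mult_right\<close>)
      show ?thesis unfolding eq
      proof (rule integral_abs_bound_mult[OF gxy])
        show "(\<lambda>t. (f' \<xi> - f' (U t)) * g t) integrable_on {x..y}"
          unfolding left_diff_distrib using kxy gi' by (intro integrable_diff integrable_on_mult_right)
        \<comment> \<open>The point \<open>\<xi>\<close> lies between \<open>U x\<close> and
          \<open>U y\<close>, and both are within \<open>d1\<close> of \<open>U t\<close>.\<close>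
        fix t assume t: "t \<in> {x..y}"
        have "\<bar>U x - U t\<bar> < d1" "\<bar>U y - U t\<bar> < d1" using D[of t x] D[of t y] t xy by auto
        then have "\<bar>\<xi> - U t\<bar> < d1" using xi by linarith
        moreover have "\<bar>U t\<bar> \<le> M" "\<bar>U x\<bar> \<le> M" "\<bar>U y\<bar> \<le> M" using M t xy by auto
        ultimately show "\<bar>f' \<xi> - f' (U t)\<bar> \<le> e" using D1[of "U t" \<xi>] xi by fastforce
      qed
    qed
    then show "\<exists>d>0. \<forall>x y. a \<le> x \<longrightarrow> x \<le> y \<longrightarrow> y \<le> b \<longrightarrow> y - x < d \<longrightarrow>
      \<bar>f (U y) - f (U x) - integral {x..y} (\<lambda>t. f' (U t) * g t)\<bar> \<le> e * integral {x..y} (\<lambda>t. \<bar>g t\<bar>)"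
      using d by blast
  qed
qed

text \<open>By polarisation: apply the chain rule to the squares of \<open>U + \<phi>\<close> and \<open>U - \<phi>\<close>.\<close>

lemma integration_by_parts_primitive:
  fixes U g \<phi> \<phi>' :: "real \<Rightarrow> real"
  assumes ab: "a \<le> b" and g: "g absolutely_integrable_on {a..b}"
    and U: "\<And>x. x \<in> {a..b} \<Longrightarrow> U x = U a + integral {a..x} g"
    and \<phi>: "\<And>x. (\<phi> has_real_derivative \<phi>' x) (at x)" and \<phi>': "continuous_on UNIV \<phi>'"
  shows "integral {a..b} (\<lambda>x. U x * \<phi>' x) = U b * \<phi> b - U a * \<phi> a - integral {a..b} (\<lambda>x. g x * \<phi> x)"
proof -
  have gi: "g integrable_on {a..b}" using g by (auto simp: absolutely_integrable_on_def)
  have cU: "continuous_on {a..b} U" by (rule primitive_continuous[OF gi U])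
  have c\<phi>: "continuous_on {a..b} \<phi>"
    by (rule DERIV_continuous_on[where D = \<phi>']) (rule has_field_derivative_at_within[OF \<phi>])
  have c\<phi>': "continuous_on {a..b} \<phi>'" using \<phi>' continuous_on_subset by blast
  have \<phi>'a: "\<phi>' absolutely_integrable_on {a..b}" by (rule absolutely_integrable_continuous_real[OF c\<phi>'])
  have \<phi>i: "integral {a..x} \<phi>' = \<phi> x - \<phi> a" if "x \<in> {a..b}" for x
    by (rule integral_unique, rule fundamental_theorem_of_calculus)
      (use that \<phi> in \<open>auto simp: has_real_derivative_iff_has_vector_derivative[symmetric] intro: has_field_derivative_at_within\<close>)
  have ix: "g integrable_on {a..x}" "\<phi>' integrable_on {a..x}" if "x \<in> {a..b}" for x
  proof -
    have "{a..x} \<subseteq> {a..b}" using that by auto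
    then show "g integrable_on {a..x}" "\<phi>' integrable_on {a..x}"
      by (rule integrable_on_subinterval[OF gi] integrable_on_subinterval[OF set_lebesgue_integral_eq_integral(1)[OF \<phi>'a]])+
  qed
  have c2: "continuous_on UNIV (\<lambda>z::real. 2 * z)" by (intro continuous_intros)
  have sq: "((\<lambda>z::real. z\<^sup>2) has_real_derivative 2 * z) (at z)" for z
    by (auto intro!: derivative_eq_intros)
  have s: "(U b + \<phi> b)\<^sup>2 - (U a + \<phi> a)\<^sup>2 = integral {a..b} (\<lambda>t. 2 * (U t + \<phi> t) * (g t + \<phi>' t))"
  proof (rule chain_rule_primitive[OF ab _ _ sq c2, where U = "\<lambda>x. U x + \<phi> x"])
    show "(\<lambda>t. g t + \<phi>' t) absolutely_integrable_on {a..b}" by (rule set_integral_add(1)[OF g \<phi>'a])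
    show "U x + \<phi> x = U a + \<phi> a + integral {a..x} (\<lambda>t. g t + \<phi>' t)" if "x \<in> {a..b}" for x
      using U[OF that] \<phi>i[OF that] Henstock_Kurzweil_Integration.integral_add[OF ix[OF that]] by linarith
  qed
  have d: "(U b - \<phi> b)\<^sup>2 - (U a - \<phi> a)\<^sup>2 = integral {a..b} (\<lambda>t. 2 * (U t - \<phi> t) * (g t - \<phi>' t))"
  proof (rule chain_rule_primitive[OF ab _ _ sq c2, where U = "\<lambda>x. U x - \<phi> x"])
    show "(\<lambda>t. g t - \<phi>' t) absolutely_integrable_on {a..b}" by (rule set_integral_diff(1)[OF g \<phi>'a])
    show "U x - \<phi> x = U a - \<phi> a + integral {a..x} (\<lambda>t. g t - \<phi>' t)" if "x \<in> {a..b}" for x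
      using U[OF that] \<phi>i[OF that] Henstock_Kurzweil_Integration.integral_diff[OF ix[OF that]] by linarith
  qed
  have i1: "(\<lambda>t. 2 * (U t + \<phi> t) * (g t + \<phi>' t)) integrable_on {a..b}"
    by (intro set_lebesgue_integral_eq_integral(1) absolutely_integrable_continuous_mult
        set_integral_add(1)[OF g \<phi>'a] continuous_intros cU c\<phi>)
  have i2: "(\<lambda>t. 2 * (U t - \<phi> t) * (g t - \<phi>' t)) integrable_on {a..b}"
    by (intro set_lebesgue_integral_eq_integral(1) absolutely_integrable_continuous_mult
        set_integral_diff(1)[OF g \<phi>'a] continuous_intros cU c\<phi>)
  have i3: "(\<lambda>t. U t * \<phi>' t) integrable_on {a..b}"
    by (intro set_lebesgue_integral_eq_integral(1) absolutely_integrable_continuous_mult \<phi>'a cU)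
  have i4: "(\<lambda>t. g t * \<phi> t) integrable_on {a..b}"
    using absolutely_integrable_continuous_mult[OF g c\<phi>]
    by (simp add: absolutely_integrable_on_def mult.commute)
  have "integral {a..b} (\<lambda>t. 2 * (U t + \<phi> t) * (g t + \<phi>' t))
      - integral {a..b} (\<lambda>t. 2 * (U t - \<phi> t) * (g t - \<phi>' t))
      = integral {a..b} (\<lambda>t. 2 * (U t + \<phi> t) * (g t + \<phi>' t) - 2 * (U t - \<phi> t) * (g t - \<phi>' t))"
    by (rule Henstock_Kurzweil_Integration.integral_diff[OF i1 i2, symmetric])
  also have "\<dots> = integral {a..b} (\<lambda>t. 4 * (U t * \<phi>' t + g t * \<phi> t))"
    by (rule arg_cong[of _ _ "integral {a..b}"]) (auto simp: fun_eq_iff algebra_simps)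
  also have "\<dots> = 4 * (integral {a..b} (\<lambda>t. U t * \<phi>' t) + integral {a..b} (\<lambda>t. g t * \<phi> t))"
    unfolding Henstock_Kurzweil_Integration.integral_mult_right Henstock_Kurzweil_Integration.integral_add[OF i3 i4] ..
  finally have "(U b + \<phi> b)\<^sup>2 - (U a + \<phi> a)\<^sup>2 - ((U b - \<phi> b)\<^sup>2 - (U a - \<phi> a)\<^sup>2)
      = 4 * (integral {a..b} (\<lambda>t. U t * \<phi>' t) + integral {a..b} (\<lambda>t. g t * \<phi> t))"
    unfolding s d .
  moreover have "(U b + \<phi> b)\<^sup>2 - (U a + \<phi> a)\<^sup>2 - ((U b - \<phi> b)\<^sup>2 - (U a - \<phi> a)\<^sup>2) = 4 * (U b * \<phi> b - U a * \<phi> a)"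
    by (simp add: power2_eq_square algebra_simps)
  ultimately have "4 * (integral {a..b} (\<lambda>t. U t * \<phi>' t) + integral {a..b} (\<lambda>t. g t * \<phi> t)) = 4 * (U b * \<phi> b - U a * \<phi> a)"
    by (rule trans[OF sym])
  then have "integral {a..b} (\<lambda>t. U t * \<phi>' t) + integral {a..b} (\<lambda>t. g t * \<phi> t) = U b * \<phi> b - U a * \<phi> a"
    by (simp only: mult_cancel_left) simp
  then show ?thesis by (rule eq_diff_eq[THEN iffD2])
qed

text \<open>On a short interval \<open>h\<close> may be frozen at its left end value, which
  contributes nothing; the local-to-global principle with \<open>P = 0\<close> absorbs the remaining
  error.\<close>

lemma integral_zero_imp_continuous_mult_zero:
  fixes d h :: "real \<Rightarrow> real"
  assumes ab: "a \<le> b" and d: "d absolutely_integrable_on {a..b}" and h: "continuous_on {a..b} h"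
    and z: "\<And>x y. a \<le> x \<Longrightarrow> x \<le> y \<Longrightarrow> y \<le> b \<Longrightarrow> integral {x..y} d = 0"
  shows "integral {a..b} (\<lambda>t. h t * d t) = 0"
proof -
  have k: "(\<lambda>t. h t * d t) absolutely_integrable_on {a..b}"
    by (rule absolutely_integrable_continuous_mult[OF d h])
  have "0 - (0::real) = integral {a..b} (\<lambda>t. h t * d t)"
  proof (rule increment_eq_integral[OF ab, where q = "\<lambda>t. \<bar>d t\<bar>" and P = "\<lambda>_. 0"])
    show "(\<lambda>t. h t * d t) integrable_on {a..b}" "(\<lambda>t. \<bar>d t\<bar>) integrable_on {a..b}"
      using d k by (auto simp: absolutely_integrable_on_def)
    fix e :: real assume e: "e > 0"
    have "uniformly_continuous_on {a..b} h"
      by (rule compact_uniformly_continuous[OF h]) auto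
    then obtain r where r: "r > 0" and R: "\<And>s t. s \<in> {a..b} \<Longrightarrow> t \<in> {a..b} \<Longrightarrow> \<bar>t - s\<bar> < r \<Longrightarrow> \<bar>h t - h s\<bar> < e"
      using e by (auto simp: uniformly_continuous_on_def dist_real_def)
    have "\<bar>0 - 0 - integral {x..y} (\<lambda>t. h t * d t)\<bar> \<le> e * integral {x..y} (\<lambda>t. \<bar>d t\<bar>)"
      if xy: "a \<le> x" "x \<le> y" "y \<le> b" "y - x < r" for x y
    proof -
      have dxy: "d absolutely_integrable_on {x..y}"
        using absolutely_integrable_on_subinterval[OF d] xy by auto
      have kxy: "(\<lambda>t. h t * d t) integrable_on {x..y}" "d integrable_on {x..y}"
        using absolutely_integrable_on_subinterval[OF k, of x y] dxy xy by (auto simp: absolutely_integrable_on_def)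
      have eq: "integral {x..y} (\<lambda>t. h t * d t) = integral {x..y} (\<lambda>t. (h t - h x) * d t)"
        unfolding left_diff_distrib
        by (subst Henstock_Kurzweil_Integration.integral_diff)
          (use kxy z[of x y] xy in \<open>auto intro: integrable_on_mult_right\<close>)
      have "\<bar>integral {x..y} (\<lambda>t. (h t - h x) * d t)\<bar> \<le> e * integral {x..y} (\<lambda>t. \<bar>d t\<bar>)"
      proof (rule integral_abs_bound_mult[OF dxy])
        show "(\<lambda>t. (h t - h x) * d t) integrable_on {x..y}"
          unfolding left_diff_distrib using kxy by (intro integrable_diff integrable_on_mult_right)
        show "\<bar>h t - h x\<bar> \<le> e" if "t \<in> {x..y}" for t using R[of x t] that xy by force
      qed
      then show ?thesis unfolding eq by simp
    qed
    then show "\<exists>r>0. \<forall>x y. a \<le> x \<longrightarrow> x \<le> y \<longrightarrow> y \<le> b \<longrightarrow> y - x < r \<longrightarrow>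
      \<bar>0 - 0 - integral {x..y} (\<lambda>t. h t * d t)\<bar> \<le> e * integral {x..y} (\<lambda>t. \<bar>d t\<bar>)"
      using r by blast
  qed
  then show ?thesis by simp
qed

text \<open>A measurable \<open>d\<close> is an almost everywhere limit of continuous functions \<open>k n\<close>, and \<open>d\<close> is
  orthogonal to every \<open>arctan (k n)\<close>, hence to \<open>arctan d\<close>, which has the sign of \<open>d\<close>.\<close>

lemma integral_zero_imp_AE_zero:
  fixes d :: "real \<Rightarrow> real"
  assumes ab: "a \<le> b" and d: "d absolutely_integrable_on {a..b}"
    and z: "\<And>x y. a \<le> x \<Longrightarrow> x \<le> y \<Longrightarrow> y \<le> b \<Longrightarrow> integral {x..y} d = 0"
  shows "AE x in lebesgue_on {a..b}. d x = 0"
proof -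
  have "d \<in> borel_measurable (lebesgue_on {a..b})"
    by (rule absolutely_integrable_imp_borel_measurable[OF d]) simp
  then have dm: "d measurable_on {a..b}" by (simp add: measurable_on_iff_borel_measurable)
  then obtain N k where N: "negligible N" and k: "\<And>n. continuous_on UNIV (k n)"
    and lim: "\<And>x. x \<notin> N \<Longrightarrow> (\<lambda>n::nat. k n x) \<longlonglongrightarrow> (if x \<in> {a..b} then d x else 0)"
    unfolding measurable_on_def by blast
  have i: "(\<lambda>t. arctan (k n t) * d t) absolutely_integrable_on {a..b}" for n
    by (rule absolutely_integrable_continuous_mult[OF d])
      (intro continuous_intros continuous_on_subset[OF k] subset_UNIV)
  have i0: "integral {a..b} (\<lambda>t. arctan (k n t) * d t) = 0" for n
    by (rule integral_zero_imp_continuous_mult_zero[OF ab d _ z])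
      (intro continuous_intros continuous_on_subset[OF k] subset_UNIV)
  \<comment> \<open>Setting both sequence and limit to 0 on the null set \<open>N\<close> gives
    convergence at every point, the form in which dominated convergence is applied.\<close>
  define F where "F n t = (if t \<in> N then 0 else arctan (k n t) * d t)" for n t
  define G where "G t = (if t \<in> N then 0 else arctan (d t) * d t)" for t
  have Fi: "F n integrable_on {a..b}" for n
    by (rule integrable_spike[OF _ N, where f = "\<lambda>t. arctan (k n t) * d t"])
      (use i[of n] in \<open>auto simp: F_def absolutely_integrable_on_def\<close>)
  have F0: "integral {a..b} (F n) = 0" for n
    by (subst i0[of n, symmetric], rule integral_spike[OF N]) (auto simp: F_def)
  have bound: "norm (F n t) \<le> pi / 2 * \<bar>d t\<bar>" if t: "t \<in> {a..b}" for n t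
  proof -
    have "\<bar>arctan (k n t)\<bar> \<le> pi / 2"
      using arctan_lbound[of "k n t"] arctan_ubound[of "k n t"] by linarith
    then have "\<bar>arctan (k n t)\<bar> * \<bar>d t\<bar> \<le> pi / 2 * \<bar>d t\<bar>" by (rule mult_right_mono) simp
    then show ?thesis by (simp add: F_def abs_mult)
  qed
  have conv: "(\<lambda>n. F n t) \<longlonglongrightarrow> G t" if t: "t \<in> {a..b}" for t
  proof (cases "t \<in> N")
    case False
    then have "(\<lambda>n. k n t) \<longlonglongrightarrow> d t" using lim[of t] t by simp
    then have "(\<lambda>n. arctan (k n t) * d t) \<longlonglongrightarrow> arctan (d t) * d t" by (intro tendsto_intros)
    then show ?thesis using False by (simp add: F_def G_def)
  qed (simp add: F_def G_def)
  have hi: "(\<lambda>t. pi / 2 * \<bar>d t\<bar>) integrable_on {a..b}"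
    using d by (intro integrable_on_mult_right) (simp add: absolutely_integrable_on_def)
  have dom: "G integrable_on {a..b}" "(\<lambda>n. integral {a..b} (F n)) \<longlonglongrightarrow> integral {a..b} G"
    by (rule dominated_convergence[OF Fi hi bound conv]; assumption)+
  then have "integral {a..b} G = 0" by (simp add: F0 LIMSEQ_const_iff)
  moreover have nonneg: "arctan y * y \<ge> 0" for y :: real
    by (cases "y \<ge> 0") (auto simp: mult_nonneg_nonneg mult_nonpos_nonpos)
  ultimately have G0: "G absolutely_integrable_on {a..b}" "integral {a..b} G = 0" "\<And>x. G x \<ge> 0"
    using dom by (auto simp: G_def intro!: nonnegative_absolutely_integrable_1)
  then have "integrable (lebesgue_on {a..b}) G"
    by (auto intro: absolutely_integrable_imp_integrable)
  then have "AE x in lebesgue_on {a..b}. G x = 0"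
    using G0 integral_nonneg_eq_0_iff_AE[of "lebesgue_on {a..b}" G]
    by (simp add: lebesgue_integral_eq_integral)
  moreover have "AE x in lebesgue_on {a..b}. x \<notin> N"
    using N AE_not_in[of N lebesgue] by (auto simp: negligible_iff_null_sets AE_restrict_space_iff)
  ultimately show ?thesis
    by eventually_elim (auto simp: G_def)
qed

section \<open>Smooth bumps and the du Bois-Reymond lemma\<close>

text \<open>\<open>exp_inv 0\<close> is the classical flat function \<open>exp (- 1 / x)\<close>.
  The powers of \<open>1 / x\<close> are included because they arise on differentiation: derivatives
  of members are linear combinations of members.\<close>

definition exp_inv :: "nat \<Rightarrow> real \<Rightarrow> real" where
  "exp_inv n x = (if x > 0 then (1 / x) ^ n * exp (- (1 / x)) else 0)"

lemma exp_inv_tendsto_0: "(exp_inv n \<longlongrightarrow> 0) (at 0)"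
proof (rule filterlim_split_at)
  have "\<forall>\<^sub>F x::real in at_left 0. 0 = exp_inv n x"
    by (rule eventually_at_leftI[of "-1"]) (auto simp: exp_inv_def)
  then show "(exp_inv n \<longlongrightarrow> 0) (at_left 0)"
    using tendsto_cong[of "\<lambda>_. 0" "exp_inv n" "at_left 0" 0] by simp
  have "((\<lambda>x::real. (inverse x) ^ n / exp (inverse x)) \<longlongrightarrow> 0) (at_right 0)"
    by (rule filterlim_compose[OF tendsto_power_div_exp_0 filterlim_inverse_at_top_right])
  moreover have "\<forall>\<^sub>F x::real in at_right 0. (inverse x) ^ n / exp (inverse x) = exp_inv n x"
    by (rule eventually_at_rightI[of _ 1]) (auto simp: exp_inv_def exp_minus field_simps)
  ultimately show "(exp_inv n \<longlongrightarrow> 0) (at_right 0)"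
    by (rule Lim_transform_eventually)
qed

lemma exp_inv_has_derivative:
  "(exp_inv n has_real_derivative exp_inv (n + 2) x + (- real n) * exp_inv (n + 1) x) (at x)"
proof (cases x "0::real" rule: linorder_cases)
  case less
  have "((\<lambda>x::real. 0) has_real_derivative 0) (at x)" by simp
  then have "(exp_inv n has_real_derivative 0) (at x)"
    by (rule has_field_derivative_transform_within_open[of _ _ _ "{..<0}"]) (use less in \<open>auto simp: exp_inv_def\<close>)
  then show ?thesis using less by (simp add: exp_inv_def)
next
  case equal
  \<comment> \<open>The difference quotient at the origin is itself \<open>exp_inv (n + 1)\<close>,
    so the preceding limit gives the derivative.\<close>
  have "\<forall>\<^sub>F h::real in at 0. exp_inv (n + 1) h = (exp_inv n (0 + h) - exp_inv n 0) / h"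
    by (auto simp: eventually_at_filter exp_inv_def)
  then have "((\<lambda>h. (exp_inv n (0 + h) - exp_inv n 0) / h) \<longlongrightarrow> 0) (at 0)"
    by (rule Lim_transform_eventually[OF exp_inv_tendsto_0])
  then show ?thesis using equal by (simp add: DERIV_def exp_inv_def)
next
  case greater
  have inv: "((\<lambda>x. 1 / x) has_real_derivative - ((1 / x)\<^sup>2)) (at x)"
    using greater by (auto intro!: derivative_eq_intros simp: power2_eq_square)
  \<comment> \<open>For \<open>n = 0\<close> the exponent \<open>n - Suc 0\<close> is truncated, but
    the factor \<open>real n\<close> vanishes.\<close>
  have "real n * (- (y\<^sup>2) * y ^ (n - Suc 0)) = (- real n) * y ^ (n + 1)" for y :: real
    by (cases n) (simp_all add: power2_eq_square algebra_simps)
  then have pow: "((\<lambda>x. (1 / x) ^ n) has_real_derivative (- real n) * (1 / x) ^ (n + 1)) (at x)"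
    using DERIV_power[OF inv, of n] by (simp only:)
  have exp: "((\<lambda>x. exp (- (1 / x))) has_real_derivative exp (- (1 / x)) * (1 / x)\<^sup>2) (at x)"
    using DERIV_fun_exp[OF DERIV_minus[OF inv]] by simp
  have "((\<lambda>x. (1 / x) ^ n * exp (- (1 / x))) has_real_derivative
      (1 / x) ^ (n + 2) * exp (- (1 / x)) + (- real n) * ((1 / x) ^ (n + 1) * exp (- (1 / x)))) (at x)"
    by (rule DERIV_cong[OF DERIV_mult[OF pow exp]]) (simp add: power_add power2_eq_square algebra_simps)
  then have "(exp_inv n has_real_derivative
      (1 / x) ^ (n + 2) * exp (- (1 / x)) + (- real n) * ((1 / x) ^ (n + 1) * exp (- (1 / x)))) (at x)"
    by (rule has_field_derivative_transform_within_open[of _ _ _ "{0<..}"]) (use greater in \<open>auto simp: exp_inv_def\<close>)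
  then show ?thesis using greater by (simp add: exp_inv_def)
qed

text \<open>Membership encodes smoothness: each member has a derivative that is again a member, so
  derivatives of all orders exist without explicit formulas. The last clause admits antiderivatives
  of bumps, from which the test functions are built.\<close>

inductive elem_smooth :: "(real \<Rightarrow> real) \<Rightarrow> bool" where
  exp_inv: "elem_smooth (exp_inv n)"
| const: "elem_smooth (\<lambda>x. c)"
| add: "elem_smooth f \<Longrightarrow> elem_smooth g \<Longrightarrow> elem_smooth (\<lambda>x. f x + g x)"
| mult: "elem_smooth f \<Longrightarrow> elem_smooth g \<Longrightarrow> elem_smooth (\<lambda>x. f x * g x)"
| affine: "elem_smooth f \<Longrightarrow> elem_smooth (\<lambda>x. f (a * x + b))"
| primitive: "elem_smooth g \<Longrightarrow> (\<And>x. (f has_real_derivative g x) (at x)) \<Longrightarrow> elem_smooth f"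

lemma elem_smooth_derivative:
  assumes "elem_smooth f"
  shows "\<exists>f'. elem_smooth f' \<and> (\<forall>x. (f has_real_derivative f' x) (at x))"
  using assms
proof induction
  case (exp_inv n)
  have "elem_smooth (\<lambda>x. exp_inv (n + 2) x + (- real n) * exp_inv (n + 1) x)"
    by (intro elem_smooth.intros)
  then show ?case using exp_inv_has_derivative by blast
next
  case (const c)
  have "elem_smooth (\<lambda>x. 0)" by (rule elem_smooth.const)
  then show ?case by (intro exI[of _ "\<lambda>x. 0"]) auto
next
  case (add f g)
  then obtain f' g' where "elem_smooth f'" "elem_smooth g'"
    "\<And>x. (f has_real_derivative f' x) (at x)" "\<And>x. (g has_real_derivative g' x) (at x)" by blast
  then show ?case
    by (intro exI[of _ "\<lambda>x. f' x + g' x"]) (auto intro: elem_smooth.intros DERIV_add)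
next
  case (mult f g)
  then obtain f' g' where *: "elem_smooth f'" "elem_smooth g'"
    "\<And>x. (f has_real_derivative f' x) (at x)" "\<And>x. (g has_real_derivative g' x) (at x)" by blast
  have "elem_smooth (\<lambda>x. f' x * g x + g' x * f x)"
    by (rule elem_smooth.add; rule elem_smooth.mult) (fact mult *)+
  then show ?case using DERIV_mult[OF *(3,4)] by blast
next
  case (affine f a b)
  then obtain f' where *: "elem_smooth f'" "\<And>x. (f has_real_derivative f' x) (at x)" by blast
  have "elem_smooth (\<lambda>x. f' (a * x + b) * a)"
    by (rule elem_smooth.mult[OF elem_smooth.affine[OF *(1)] elem_smooth.const])
  moreover have "((\<lambda>x. f (a * x + b)) has_real_derivative f' (a * x + b) * a) (at x)" for x
    by (rule DERIV_chain2[OF *(2)]) (auto intro!: derivative_eq_intros)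
  ultimately show ?case by blast
qed blast

lemma elem_smooth_diff:
  assumes "elem_smooth f" "elem_smooth g" shows "elem_smooth (\<lambda>x. f x - g x)"
  using elem_smooth.add[OF assms(1) elem_smooth.mult[OF elem_smooth.const[of "-1"] assms(2)]] by simp

lemma elem_smooth_shift: "elem_smooth f \<Longrightarrow> elem_smooth (\<lambda>x. f (x - a))"
  using elem_smooth.affine[of f 1 "-a"] by simp

lemma elem_smooth_deriv: "elem_smooth f \<Longrightarrow> elem_smooth (deriv f)"
  using elem_smooth_derivative[of f] DERIV_imp_deriv by (metis ext)

lemma elem_smooth_iter_deriv: "elem_smooth f \<Longrightarrow> elem_smooth ((deriv ^^ k) f)"
  by (induction k) (auto intro: elem_smooth_deriv)

lemma elem_smooth_field_differentiable:
  "elem_smooth f \<Longrightarrow> ((deriv ^^ k) f) field_differentiable (at x)"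
  using elem_smooth_derivative[OF elem_smooth_iter_deriv] field_differentiable_def by blast

lemma elem_smooth_continuous: "elem_smooth f \<Longrightarrow> continuous_on S f"
  using elem_smooth_derivative by (metis DERIV_isCont continuous_at_imp_continuous_on)

definition bump :: "real \<Rightarrow> real \<Rightarrow> real" where
  "bump e x = exp_inv 0 (x + e) * exp_inv 0 (e - x)"

lemma bump_smooth: "elem_smooth (bump e)"
  unfolding bump_def
  using elem_smooth.mult[OF elem_smooth.affine[OF elem_smooth.exp_inv[of 0], of 1 e]
      elem_smooth.affine[OF elem_smooth.exp_inv[of 0], of "-1" e]] by (simp add: bump_def)

lemma bump_pos: "\<bar>x\<bar> < e \<Longrightarrow> bump e x > 0"
  and bump_zero: "\<bar>x\<bar> \<ge> e \<Longrightarrow> bump e x = 0"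
  and bump_nonneg: "bump e x \<ge> 0"
  by (auto simp: bump_def exp_inv_def)

text \<open>The primitive is a smooth step, constant on either side of the bump. The difference of
  two translates therefore has compact support, and its derivative is a difference of bumps of equal
  mass.\<close>

lemma bump_primitive:
  assumes "e > 0"
  shows "\<exists>B. elem_smooth B \<and> (\<forall>x. (B has_real_derivative bump e x) (at x)) \<and>
    (\<forall>x\<le>-e. B x = 0) \<and> (\<forall>x\<ge>e. B x = B e) \<and> B e > 0"
proof -
  \<comment> \<open>Starting strictly to the left of the support makes every \<open>x\<close> that
    is at least \<open>- e\<close> an interior point of \<open>{c..x + 1}\<close>. For
    \<open>x < c\<close> the interval is empty and the integral is 0.\<close>
  define c where "c = - e - 1"
  define B where "B x = integral {c..x} (bump e)" for x
  have cont: "continuous_on S (bump e)" for S by (rule elem_smooth_continuous[OF bump_smooth])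
  have zero: "B x = 0" if "x \<le> - e" for x
  proof -
    have "B x = integral {c..x} (\<lambda>_. 0)"
      unfolding B_def using that assms by (intro integral_cong bump_zero) auto
    then show ?thesis by simp
  qed
  have der: "(B has_real_derivative bump e x) (at x)" for x
  proof (cases "x < - e")
    case True
    have "((\<lambda>x::real. 0) has_real_derivative 0) (at x)" by simp
    then have "(B has_real_derivative 0) (at x)"
      by (rule has_field_derivative_transform_within_open[of _ _ _ "{..<- e}"]) (use True zero in auto)
    then show ?thesis using True bump_zero[of e x] assms by simp
  next
    case False
    have "(B has_real_derivative bump e x) (at x within {c..x + 1})"
      unfolding B_def by (rule integral_has_real_derivative[OF cont]) (use False in \<open>auto simp: c_def\<close>)
    moreover have "x \<in> interior {c..x + 1}" using False by (simp add: c_def)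
    ultimately show ?thesis by (metis at_within_interior)
  qed
  have const: "B x = B e" if x: "x \<ge> e" for x
  proof (cases "x = e")
    case False
    then obtain z where "e < z" "B x - B e = (x - e) * bump e z"
      using MVT2[of e x B "bump e"] der x by force
    then show ?thesis using bump_zero[of e z] assms by simp
  qed simp
  obtain z where "- e < z" "z < e" "B e - B (- e) = (e - - e) * bump e z"
    using MVT2[of "- e" e B "bump e"] der assms by force
  then have pos: "B e > 0" using zero[of "- e"] bump_pos[of z e] assms by auto
  show ?thesis
    by (intro exI[of _ B] conjI elem_smooth.primitive[OF bump_smooth der] allI impI der zero const pos)
qed

lemma test_functionD:
  assumes "\<phi> \<in> test_functions"
  shows "(\<phi> has_real_derivative deriv \<phi> x) (at x)" "continuous_on S (deriv \<phi>)" "continuous_on S \<phi>"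
    "\<phi> 0 = 0" "\<phi> 1 = 0"
proof -
  note t = CollectD[OF assms[unfolded test_functions_def]]
  have *: "((deriv ^^ k) \<phi>) field_differentiable (at x)" for k x
    by (rule conjunct1[OF t, rule_format])
  show d: "(\<phi> has_real_derivative deriv \<phi> x) (at x)" for x
    using *[of 0 x] by (simp add: DERIV_deriv_iff_field_differentiable)
  have "deriv \<phi> field_differentiable (at x)" for x using *[of 1 x] by simp
  then show "continuous_on S (deriv \<phi>)"
    by (intro continuous_at_imp_continuous_on ballI field_differentiable_imp_continuous_at)
  show "continuous_on S \<phi>"
    by (intro continuous_at_imp_continuous_on ballI DERIV_isCont[OF d])
  have "closure {x. \<phi> x \<noteq> 0} \<subseteq> {0<..<1}" by (rule conjunct2[OF conjunct2[OF t]])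
  then have *: "{x. \<phi> x \<noteq> 0} \<subseteq> {0<..<1}" by (rule subset_trans[OF closure_subset])
  show "\<phi> 0 = 0" using subsetD[OF *, of 0] by fastforce
  show "\<phi> 1 = 0" using subsetD[OF *, of 1] by fastforce
qed

lemma elem_smooth_test_function:
  assumes "elem_smooth \<phi>" "0 < l" "r < 1" "\<And>x. x \<notin> {l..r} \<Longrightarrow> \<phi> x = 0"
  shows "\<phi> \<in> test_functions"
proof -
  have "{x. \<phi> x \<noteq> 0} \<subseteq> {l..r}" using assms(4) by blast
  then have sub: "closure {x. \<phi> x \<noteq> 0} \<subseteq> {l..r}" by (rule closure_minimal) simp
  then have "compact (closure {x. \<phi> x \<noteq> 0})"
    by (metis bounded_closed_interval bounded_subset closed_closure compact_eq_bounded_closed)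
  moreover have "closure {x. \<phi> x \<noteq> 0} \<subseteq> {0<..<1}"
    using assms(2,3) by (intro subset_trans[OF sub]) auto
  ultimately show ?thesis
    using elem_smooth_field_differentiable[OF assms(1)]
    unfolding test_functions_def by simp
qed

text \<open>Test with a primitive of the difference of two equal bumps, one centred at \<open>a\<close> and one at \<open>b\<close>.\<close>

lemma du_Bois_Reymond_le:
  fixes w :: "real \<Rightarrow> real"
  assumes w: "w absolutely_integrable_on {0..1}"
    and test: "\<And>\<phi>. \<phi> \<in> test_functions \<Longrightarrow> integral {0..1} (\<lambda>x. w x * deriv \<phi> x) = 0"
    and ab: "0 < a" "a < 1" "0 < b" "b < 1" and cont: "isCont w a" "isCont w b"
  shows "w a \<le> w b"
proof (rule ccontr)
  assume "\<not> w a \<le> w b"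
  \<comment> \<open>With a third of the gap, \<open>w a - h\<close> still exceeds
    \<open>w b + h\<close>.\<close>
  define h where "h = (w a - w b) / 3"
  have h: "h > 0" using \<open>\<not> w a \<le> w b\<close> by (simp add: h_def)
  obtain e1 where e1: "e1 > 0" "\<And>x. \<bar>x - a\<bar> < e1 \<Longrightarrow> \<bar>w x - w a\<bar> < h"
    using cont(1)[unfolded continuous_at_eps_delta, rule_format, OF h] by (auto simp: dist_real_def)
  obtain e2 where e2: "e2 > 0" "\<And>x. \<bar>x - b\<bar> < e2 \<Longrightarrow> \<bar>w x - w b\<bar> < h"
    using cont(2)[unfolded continuous_at_eps_delta, rule_format, OF h] by (auto simp: dist_real_def)
  \<comment> \<open>The bound by \<open>e1\<close> and \<open>e2\<close> keeps \<open>w\<close>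
    within \<open>h\<close> of \<open>w a\<close> and \<open>w b\<close> on the two supports; the
    other bounds keep both supports inside the open unit interval.\<close>
  define e where "e = min (min e1 e2) (min (min (a / 2) ((1 - a) / 2)) (min (b / 2) ((1 - b) / 2)))"
  have e: "e > 0" "e \<le> e1" "e \<le> e2" "e \<le> a / 2" "e \<le> (1 - a) / 2" "e \<le> b / 2" "e \<le> (1 - b) / 2"
    using e1(1) e2(1) ab unfolding e_def by (simp_all only: min_less_iff_conj min_le_iff_disj) auto
  obtain B where B: "elem_smooth B" "\<And>x. (B has_real_derivative bump e x) (at x)"
    "\<And>x. x \<le> - e \<Longrightarrow> B x = 0" "\<And>x. x \<ge> e \<Longrightarrow> B x = B e" "B e > 0"
    using bump_primitive[OF e(1)] by blast
  define \<phi> where "\<phi> x = B (x - a) - B (x - b)" for x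
  have "\<phi> \<in> test_functions"
  proof (rule elem_smooth_test_function)
    show "elem_smooth \<phi>" unfolding \<phi>_def by (intro elem_smooth_diff elem_smooth_shift B(1))
    show "0 < min a b - e" "max a b + e < 1" using e ab by auto
    show "\<phi> x = 0" if "x \<notin> {min a b - e..max a b + e}" for x
    proof (cases "x < min a b - e")
      case True then show ?thesis using B(3)[of "x - a"] B(3)[of "x - b"] by (simp add: \<phi>_def)
    next
      case False then show ?thesis using that B(4)[of "x - a"] B(4)[of "x - b"] by (simp add: \<phi>_def)
    qed
  qed
  moreover have "deriv \<phi> x = bump e (x - a) - bump e (x - b)" for x
    unfolding \<phi>_def
    by (intro DERIV_imp_deriv DERIV_diff) (auto intro!: DERIV_chain2[OF B(2), where s = UNIV and Db = 1, simplified] derivative_eq_intros)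
  ultimately have z: "integral {0..1} (\<lambda>x. w x * bump e (x - a) - w x * bump e (x - b)) = 0"
    using test[of \<phi>] by (simp add: right_diff_distrib)
  have bc: "continuous_on {0..1} (\<lambda>x. bump e (x - c))" for c
    by (rule elem_smooth_continuous[OF elem_smooth_shift[OF bump_smooth]])
  have bi: "(\<lambda>x. bump e (x - c)) integrable_on {0..1}" for c
    by (rule integrable_continuous_real[OF bc])
  have wb: "(\<lambda>x. w x * bump e (x - c)) integrable_on {0..1}" for c
    using absolutely_integrable_continuous_mult[OF w bc[of c]] by (simp add: absolutely_integrable_on_def mult.commute)
  have bI: "integral {0..1} (\<lambda>x. bump e (x - c)) = B e" if "e \<le> c" "c \<le> 1 - e" for c
  proof -
    have "((\<lambda>x. bump e (x - c)) has_integral B (1 - c) - B (0 - c)) {0..1}"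
    proof (rule fundamental_theorem_of_calculus)
      show "((\<lambda>x. B (x - c)) has_vector_derivative bump e (x - c)) (at x within {0..1})" for x
        unfolding has_real_derivative_iff_has_vector_derivative[symmetric]
        by (rule has_field_derivative_at_within, rule DERIV_chain2[OF B(2), where Db = 1, simplified])
          (auto intro!: derivative_eq_intros)
    qed simp
    then show ?thesis using B(3)[of "- c"] B(4)[of "1 - c"] that by (simp add: integral_unique)
  qed
  have "integral {0..1} (\<lambda>x. (w a - h) * bump e (x - a)) \<le> integral {0..1} (\<lambda>x. w x * bump e (x - a))"
  proof (rule integral_le[OF integrable_on_mult_right[OF bi] wb])
    fix x
    show "(w a - h) * bump e (x - a) \<le> w x * bump e (x - a)"
      using e1(2)[of x] e(2) bump_zero[of e "x - a"] bump_nonneg[of e "x - a"]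
      by (cases "\<bar>x - a\<bar> < e") (auto intro!: mult_right_mono)
  qed
  moreover have "integral {0..1} (\<lambda>x. w x * bump e (x - b)) \<le> integral {0..1} (\<lambda>x. (w b + h) * bump e (x - b))"
  proof (rule integral_le[OF wb integrable_on_mult_right[OF bi]])
    fix x
    show "w x * bump e (x - b) \<le> (w b + h) * bump e (x - b)"
      using e2(2)[of x] e(3) bump_zero[of e "x - b"] bump_nonneg[of e "x - b"]
      by (cases "\<bar>x - b\<bar> < e") (auto intro!: mult_right_mono)
  qed
  moreover have "integral {0..1} (\<lambda>x. w x * bump e (x - a)) = integral {0..1} (\<lambda>x. w x * bump e (x - b))"
    using z Henstock_Kurzweil_Integration.integral_diff[OF wb[of a] wb[of b]] by simp
  ultimately have "(w a - h) * B e \<le> (w b + h) * B e"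
    using bI[of a] bI[of b] e ab by simp
  then have "w a - h \<le> w b + h" using B(5) by simp
  then show False using h by (simp add: h_def field_simps)
qed

text \<open>Continuity is asked only at the two points compared, so that the result also applies to
  a function with a jump elsewhere, as in the exclusion of the sign function from
  \<open>H1\<close>.\<close>

lemma du_Bois_Reymond:
  fixes w :: "real \<Rightarrow> real"
  assumes "w absolutely_integrable_on {0..1}"
    and "\<And>\<phi>. \<phi> \<in> test_functions \<Longrightarrow> integral {0..1} (\<lambda>x. w x * deriv \<phi> x) = 0"
    and "0 < a" "a < 1" "0 < b" "b < 1" "isCont w a" "isCont w b"
  shows "w a = w b"
  using du_Bois_Reymond_le[OF assms(1,2), of a b] du_Bois_Reymond_le[OF assms(1,2), of b a] assms by simp

section \<open>Sobolev functions on the unit interval\<close>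

text \<open>The endpoints form a null set. This is the bridge from the measure in the definitions to
  integrals over closed intervals, in which the computations are carried out.\<close>

lemma integrable_unit_leb_iff:
  fixes f :: "real \<Rightarrow> real"
  shows "integrable unit_leb f \<longleftrightarrow> f absolutely_integrable_on {0..1}"
  unfolding absolutely_integrable_on_Icc_iff_Ioo unfolding set_integrable_def
  by (rule integrable_restrict_space) simp

lemma integral_unit_leb:
  fixes f :: "real \<Rightarrow> real"
  assumes "f absolutely_integrable_on {0..1}"
  shows "integral\<^sup>L unit_leb f = integral {0..1} f"
  using assms by (simp add: lebesgue_integral_eq_integral integrable_unit_leb_iff integral_open_interval_real)

section \<open>Square-integrable functions\<close>

lemma L2_mult:
  assumes "g \<in> L2" "h \<in> L2"
  shows "(\<lambda>x. g x * h x) absolutely_integrable_on {0..1}"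
proof -
  have [measurable]: "g \<in> borel_measurable unit_leb" "h \<in> borel_measurable unit_leb"
    using assms by (auto simp: L2_def)
  have "integrable unit_leb (\<lambda>x. g x * h x)"
  proof (rule Bochner_Integration.integrable_bound)
    show "integrable unit_leb (\<lambda>x. (g x)\<^sup>2 + (h x)\<^sup>2)"
      using assms by (auto simp: L2_def)
    show "AE x in unit_leb. norm (g x * h x) \<le> norm ((g x)\<^sup>2 + (h x)\<^sup>2)"
    proof (rule AE_I2)
      fix x
      have "0 \<le> (\<bar>g x\<bar> - \<bar>h x\<bar>)\<^sup>2" by simp
      then have "2 * (\<bar>g x\<bar> * \<bar>h x\<bar>) \<le> (g x)\<^sup>2 + (h x)\<^sup>2" by (simp add: power2_diff)
      moreover have "0 \<le> \<bar>g x\<bar> * \<bar>h x\<bar>" by simp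
      ultimately have "\<bar>g x\<bar> * \<bar>h x\<bar> \<le> (g x)\<^sup>2 + (h x)\<^sup>2" by linarith
      then show "norm (g x * h x) \<le> norm ((g x)\<^sup>2 + (h x)\<^sup>2)" by (simp add: abs_mult)
    qed
  qed measurable
  then show ?thesis by (simp add: integrable_unit_leb_iff)
qed

lemma L2_bounded:
  assumes "g \<in> borel_measurable unit_leb" "\<And>x. x \<in> {0<..<1} \<Longrightarrow> \<bar>g x\<bar> \<le> c"
  shows "g \<in> L2"
proof -
  note [measurable] = assms(1)
  interpret finite_measure unit_leb
    by (rule finite_measureI) (simp add: emeasure_restrict_space)
  have "integrable unit_leb (\<lambda>x. (g x)\<^sup>2)"
  proof (rule integrable_const_bound[of _ "c\<^sup>2"])
    show "AE x in unit_leb. norm ((g x)\<^sup>2) \<le> c\<^sup>2"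
      by (rule AE_I2) (use assms(2) in \<open>auto simp: abs_le_square_iff[symmetric] space_restrict_space intro: order_trans[OF _ abs_ge_self]\<close>)
  qed measurable
  then show ?thesis using assms(1) by (simp add: L2_def)
qed

lemma measurable_unit_leb_continuous:
  "continuous_on {0..1} h \<Longrightarrow> (h :: real \<Rightarrow> real) \<in> borel_measurable unit_leb"
  by (rule continuous_imp_measurable_on_sets_lebesgue) (auto intro: continuous_on_subset)

lemma L2_continuous:
  assumes "continuous_on {0..1} h" shows "h \<in> L2"
proof -
  have "bounded (h ` {0..1})"
    using assms compact_continuous_image compact_imp_bounded by blast
  then obtain c where "\<forall>x\<in>{0..1}. \<bar>h x\<bar> \<le> c" unfolding bounded_real by blast
  then show ?thesis by (intro L2_bounded[of _ c] measurable_unit_leb_continuous assms) auto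
qed

lemma L2_absolutely_integrable: "g \<in> L2 \<Longrightarrow> g absolutely_integrable_on {0..1}"
  using L2_mult[OF _ L2_continuous[OF continuous_on_const[of _ 1]]] by simp

lemma L2_square_integrable: "g \<in> L2 \<Longrightarrow> (\<lambda>x. (g x)\<^sup>2) absolutely_integrable_on {0..1}"
  by (simp add: L2_def integrable_unit_leb_iff)

lemma L2_integrable_on:
  assumes "g \<in> L2" "0 \<le> a" "b \<le> 1"
  shows "g integrable_on {a..b}" "(\<lambda>x. (g x)\<^sup>2) integrable_on {a..b}"
proof -
  have "{a..b} \<subseteq> {0..1}" using assms by auto
  then show "g integrable_on {a..b}" "(\<lambda>x. (g x)\<^sup>2) integrable_on {a..b}"
    using L2_absolutely_integrable[OF assms(1)] L2_square_integrable[OF assms(1)]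
    by (meson integrable_on_subinterval set_lebesgue_integral_eq_integral(1))+
qed

lemma L2_continuous_mult:
  assumes g: "g \<in> L2" and h: "continuous_on {0..1} h"
  shows "(\<lambda>x. h x * g x) \<in> L2"
proof -
  have "continuous_on {0..1} (\<lambda>x. (h x)\<^sup>2)" using h by (intro continuous_intros)
  from absolutely_integrable_continuous_mult[OF L2_square_integrable[OF g] this]
  have "integrable unit_leb (\<lambda>x. (h x * g x)\<^sup>2)" by (simp add: integrable_unit_leb_iff power_mult_distrib)
  moreover have "(\<lambda>x. h x * g x) \<in> borel_measurable unit_leb"
    using g measurable_unit_leb_continuous[OF h] by (auto simp: L2_def)
  ultimately show ?thesis by (simp add: L2_def)
qed

lemma L2_diff:
  assumes "g \<in> L2" "h \<in> L2" shows "(\<lambda>x. g x - h x) \<in> L2"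
proof -
  have "integrable unit_leb (\<lambda>x. (g x)\<^sup>2 + (h x)\<^sup>2 - 2 * (g x * h x))"
    using assms L2_mult[OF assms] by (auto simp: L2_def integrable_unit_leb_iff[symmetric])
  moreover have "(\<lambda>x. (g x)\<^sup>2 + (h x)\<^sup>2 - 2 * (g x * h x)) = (\<lambda>x. (g x - h x)\<^sup>2)"
    by (auto simp: fun_eq_iff power2_diff)
  ultimately show ?thesis using assms by (auto simp: L2_def)
qed

lemma l2norm_eq: "g \<in> L2 \<Longrightarrow> l2norm g = sqrt (integral {0..1} (\<lambda>x. (g x)\<^sup>2))"
  by (simp add: l2norm_def integral_unit_leb L2_square_integrable)

lemma l2norm_nonneg [simp]: "l2norm g \<ge> 0"
  by (simp add: l2norm_def)

text \<open>A square that is not integrable has integral 0 by convention.\<close>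

lemma integral_square_nonneg: "integral S (\<lambda>x. (g x)\<^sup>2 :: real) \<ge> 0"
  by (cases "(\<lambda>x. (g x)\<^sup>2) integrable_on S") (auto intro: integral_nonneg simp: not_integrable_integral)

lemma l2norm_power2: "g \<in> L2 \<Longrightarrow> (l2norm g)\<^sup>2 = integral {0..1} (\<lambda>x. (g x)\<^sup>2)"
  by (simp add: l2norm_eq integral_square_nonneg)

lemma l2norm_cong_AE:
  assumes "g \<in> L2" "h \<in> L2" "AE x in unit_leb. g x = h x"
  shows "l2norm g = l2norm h"
  unfolding l2norm_def
  by (intro arg_cong[of _ _ sqrt] integral_cong_AE) (use assms in \<open>auto simp: L2_def\<close>)

text \<open>Expand the nonnegative integral of the squared deviation of \<open>g\<close> from its
  mean. The case \<open>a = b\<close> is separate because the mean divides by the length.\<close>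

lemma Cauchy_Schwarz_interval:
  fixes g :: "real \<Rightarrow> real"
  assumes "a \<le> b" "g integrable_on {a..b}" "(\<lambda>x. (g x)\<^sup>2) integrable_on {a..b}"
  shows "(integral {a..b} g)\<^sup>2 \<le> (b - a) * integral {a..b} (\<lambda>x. (g x)\<^sup>2)"
proof (cases "a = b")
  case False
  define m where "m = integral {a..b} g / (b - a)"
  have m: "integral {a..b} g = m * (b - a)" using False by (simp add: m_def)
  have "0 \<le> integral {a..b} (\<lambda>x. (g x - m)\<^sup>2)" by (rule integral_square_nonneg)
  also have "(\<lambda>x. (g x - m)\<^sup>2) = (\<lambda>x. ((g x)\<^sup>2 - (2 * m) * g x) + m\<^sup>2)"
    by (auto simp: power2_diff algebra_simps)
  also have "integral {a..b} \<dots> = integral {a..b} (\<lambda>x. (g x)\<^sup>2) - (2 * m) * integral {a..b} g + m\<^sup>2 * (b - a)"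
    using assms
    by (subst Henstock_Kurzweil_Integration.integral_add)
      (auto simp: Henstock_Kurzweil_Integration.integral_diff integrable_diff integrable_on_mult_right integrable_const_ivl)
  finally have "m * m * (b - a) \<le> integral {a..b} (\<lambda>x. (g x)\<^sup>2)"
    unfolding m by (simp add: power2_eq_square algebra_simps)
  then have "(b - a) * (m * m * (b - a)) \<le> (b - a) * integral {a..b} (\<lambda>x. (g x)\<^sup>2)"
    using assms(1) by (intro mult_left_mono) auto
  then show ?thesis by (simp add: m power2_eq_square algebra_simps)
qed simp

lemma L2_subinterval_square_le:
  assumes "g \<in> L2" "0 \<le> a" "b \<le> 1"
  shows "integral {a..b} (\<lambda>x. (g x)\<^sup>2) \<le> integral {0..1} (\<lambda>x. (g x)\<^sup>2)"
  by (rule integral_subset_le) (use assms L2_integrable_on(2)[OF assms(1)] in auto)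

lemma L2_integral_bound:
  assumes "g \<in> L2" "0 \<le> a" "a \<le> b" "b \<le> 1"
  shows "\<bar>integral {a..b} g\<bar> \<le> l2norm g"
proof -
  have "(integral {a..b} g)\<^sup>2 \<le> (b - a) * integral {a..b} (\<lambda>x. (g x)\<^sup>2)"
    by (rule Cauchy_Schwarz_interval) (use assms L2_integrable_on[OF assms(1)] in auto)
  also have "\<dots> \<le> 1 * integral {a..b} (\<lambda>x. (g x)\<^sup>2)"
    by (rule mult_right_mono) (use assms integral_square_nonneg in auto)
  also have "\<dots> \<le> (l2norm g)\<^sup>2"
    using L2_subinterval_square_le[of g a b] assms by (simp add: l2norm_power2)
  finally show ?thesis by (intro power2_le_imp_le[OF _ l2norm_nonneg]) simp
qed

section \<open>Weak derivatives and primitives\<close>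

lemma weak_derivI_primitive:
  assumes g: "g \<in> L2" and U: "\<And>x. x \<in> {0..1} \<Longrightarrow> U x = U 0 + integral {0..x} g"
  shows "has_weak_deriv U g"
  unfolding has_weak_deriv_def
proof
  fix \<phi> assume \<phi>: "\<phi> \<in> test_functions"
  note t = test_functionD[OF \<phi>]
  have ga: "g absolutely_integrable_on {0..1}" by (rule L2_absolutely_integrable[OF g])
  have U2: "U \<in> L2"
    by (rule L2_continuous, rule primitive_continuous[OF set_lebesgue_integral_eq_integral(1)[OF ga] U])
  have "integral {0..1} (\<lambda>x. U x * deriv \<phi> x) = - integral {0..1} (\<lambda>x. g x * \<phi> x)"
    using integration_by_parts_primitive[OF _ ga U t(1) t(2)] t(4,5) by simp
  then show "(LINT x|unit_leb. U x * deriv \<phi> x) = - (LINT x|unit_leb. g x * \<phi> x)"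
    using L2_mult[OF U2 L2_continuous[OF t(2)]] L2_mult[OF g L2_continuous[OF t(3)]]
    by (simp add: integral_unit_leb)
qed

lemma H1_contI_primitive:
  assumes g: "g \<in> L2" and U: "\<And>x. x \<in> {0..1} \<Longrightarrow> U x = U 0 + integral {0..x} g"
  shows "U \<in> H1_cont"
proof -
  have "continuous_on {0..1} U"
    by (rule primitive_continuous[OF set_lebesgue_integral_eq_integral(1)[OF L2_absolutely_integrable[OF g]] U])
  then show ?thesis using weak_derivI_primitive[OF assms] g L2_continuous
    by (auto simp: H1_cont_def H1_def)
qed

text \<open>By parts, the primitive of \<open>g\<close> satisfies the same weak identity as
  \<open>u\<close>. Only \<open>u \<in> L2\<close> is assumed, because the sign function has to be
  covered as well.\<close>

lemma weak_deriv_orthogonal: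
  assumes u: "u \<in> L2" and g: "g \<in> L2" "has_weak_deriv u g" and \<phi>: "\<phi> \<in> test_functions"
  shows "integral {0..1} (\<lambda>x. (u x - integral {0..x} g) * deriv \<phi> x) = 0"
proof -
  note t = test_functionD[OF \<phi>]
  have ga: "g absolutely_integrable_on {0..1}" by (rule L2_absolutely_integrable[OF g(1)])
  define G where "G x = integral {0..x} g" for x
  have G2: "G \<in> L2" unfolding G_def
    by (intro L2_continuous indefinite_integral_continuous_1 set_lebesgue_integral_eq_integral(1) ga)
  have i: "(\<lambda>x. u x * deriv \<phi> x) absolutely_integrable_on {0..1}" "(\<lambda>x. G x * deriv \<phi> x) absolutely_integrable_on {0..1}"
    "(\<lambda>x. g x * \<phi> x) absolutely_integrable_on {0..1}"
    using L2_mult[OF u L2_continuous[OF t(2)]] L2_mult[OF G2 L2_continuous[OF t(2)]] L2_mult[OF g(1) L2_continuous[OF t(3)]] .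
  have "integral {0..1} (\<lambda>x. G x * deriv \<phi> x) = - integral {0..1} (\<lambda>x. g x * \<phi> x)"
    using integration_by_parts_primitive[OF _ ga _ t(1) t(2), of G] t(4,5) by (simp add: G_def)
  moreover have "integral {0..1} (\<lambda>x. u x * deriv \<phi> x) = - integral {0..1} (\<lambda>x. g x * \<phi> x)"
    using g(2)[unfolded has_weak_deriv_def, rule_format, OF \<phi>] by (simp only: integral_unit_leb i)
  ultimately have "integral {0..1} (\<lambda>x. u x * deriv \<phi> x - G x * deriv \<phi> x) = 0"
    using i by (subst Henstock_Kurzweil_Integration.integral_diff) (auto dest: set_lebesgue_integral_eq_integral(1))
  then show ?thesis by (simp add: G_def left_diff_distrib)
qed

lemma weak_deriv_primitive:
  assumes u: "u \<in> H1_cont" and g: "g \<in> L2" "has_weak_deriv u g" and x: "x \<in> {0..1}"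
  shows "u x = u 0 + integral {0..x} g"
proof -
  define w where "w x = u x - integral {0..x} g" for x
  have uc: "continuous_on {0..1} u" using u by (simp add: H1_cont_def)
  have gi: "g integrable_on {0..1}" using L2_integrable_on(1)[OF g(1), of 0 1] by simp
  have wc: "continuous_on {0..1} w" unfolding w_def
    by (intro continuous_intros uc indefinite_integral_continuous_1 gi)
  have cont: "isCont w a" if "a \<in> {0<..<1}" for a
    using wc that continuous_on_interior[of "{0..1}" w a] by simp
  \<comment> \<open>The midpoint is an arbitrary reference point. Test functions see only the open
    interval; continuity of \<open>w\<close> carries the constant to the endpoints.\<close>
  have "w a = w (1 / 2)" if a: "a \<in> {0<..<1}" for a
  proof (rule du_Bois_Reymond[of w])
    show "w absolutely_integrable_on {0..1}" by (rule absolutely_integrable_continuous_real[OF wc])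
    show "integral {0..1} (\<lambda>x. w x * deriv \<phi> x) = 0" if "\<phi> \<in> test_functions" for \<phi>
      unfolding w_def by (rule weak_deriv_orthogonal[OF L2_continuous[OF uc] g that])
  qed (use a cont in auto)
  note const = this
  have closed: "w a = w (1 / 2)" if a: "a \<in> {0..1}" for a
  proof (rule continuous_constant_on_closure[of "{0<..<1}" w])
    show "continuous_on (closure {0<..<1}) w" "a \<in> closure {0<..<1}" using wc a by simp_all
  qed (rule const)
  have "w 0 = w x" using closed[of 0] closed[OF x] by simp
  then show ?thesis by (simp add: w_def)
qed

lemma weak_deriv_props:
  assumes "u \<in> H1_cont"
  shows "weak_deriv u \<in> L2" "has_weak_deriv u (weak_deriv u)"
proof -
  have "\<exists>g. g \<in> L2 \<and> has_weak_deriv u g" using assms by (auto simp: H1_cont_def H1_def)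
  from someI_ex[OF this] show "weak_deriv u \<in> L2" "has_weak_deriv u (weak_deriv u)"
    by (auto simp: weak_deriv_def)
qed

lemma H1_cont_increment:
  assumes u: "u \<in> H1_cont" and "0 \<le> x" "x \<le> y" "y \<le> 1"
  shows "u y - u x = integral {x..y} (weak_deriv u)"
  by (rule primitive_increment[OF L2_integrable_on(1)[OF weak_deriv_props(1)[OF u], of 0 1]
      weak_deriv_primitive[OF u weak_deriv_props[OF u]]]) (use assms in auto)

text \<open>Two weak derivatives have equal integrals over all subintervals and hence agree almost
  everywhere. The norm of the unspecified \<open>weak_deriv U\<close> can thus be computed from an
  explicit \<open>g\<close>.\<close>

lemma l2norm_weak_deriv_eq:
  assumes g: "g \<in> L2" and U: "\<And>x. x \<in> {0..1} \<Longrightarrow> U x = U 0 + integral {0..x} g"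
  shows "l2norm (weak_deriv U) = l2norm g"
proof -
  have U1: "U \<in> H1_cont" by (rule H1_contI_primitive[OF assms])
  note w = weak_deriv_props(1)[OF U1]
  have d: "(\<lambda>x. weak_deriv U x - g x) \<in> L2" by (rule L2_diff[OF w g])
  have "integral {x..y} (\<lambda>x. weak_deriv U x - g x) = 0" if "0 \<le> x" "x \<le> y" "y \<le> 1" for x y
    using H1_cont_increment[OF U1 that] primitive_increment[OF L2_integrable_on(1)[OF g, of 0 1] U, of x y] that
      Henstock_Kurzweil_Integration.integral_diff[OF L2_integrable_on(1)[OF w] L2_integrable_on(1)[OF g], of x y] by simp
  then have "AE x in lebesgue_on {0..1}. weak_deriv U x - g x = 0"
    by (intro integral_zero_imp_AE_zero L2_absolutely_integrable[OF d]) auto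
  then have "AE x in unit_leb. weak_deriv U x = g x"
    by (simp add: AE_restrict_space_iff) (erule eventually_mono, simp)
  then show ?thesis by (rule l2norm_cong_AE[OF w g])
qed

lemma H1_cont_comp:
  assumes u: "u \<in> H1_cont"
    and f: "\<And>z. (f has_real_derivative f' z) (at z)" and f': "continuous_on UNIV f'"
  shows "(\<lambda>y. f (u y)) \<in> H1_cont"
proof (rule H1_contI_primitive)
  note w = weak_deriv_props[OF u]
  have uc: "continuous_on {0..1} u" using u by (simp add: H1_cont_def)
  show "(\<lambda>t. f' (u t) * weak_deriv u t) \<in> L2"
    by (rule L2_continuous_mult[OF w(1) continuous_on_compose2[OF f' uc]]) auto
  fix x :: real assume x: "x \<in> {0..1}"
  have "f (u x) - f (u 0) = integral {0..x} (\<lambda>t. f' (u t) * weak_deriv u t)"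
  proof (rule chain_rule_primitive[OF _ _ _ f f'])
    show "weak_deriv u absolutely_integrable_on {0..x}"
      by (rule absolutely_integrable_on_subinterval[OF L2_absolutely_integrable[OF w(1)]]) (use x in auto)
    show "u t = u 0 + integral {0..t} (weak_deriv u)" if "t \<in> {0..x}" for t
      by (rule weak_deriv_primitive[OF u w]) (use that x in auto)
  qed (use x in auto)
  then show "f (u x) = f (u 0) + integral {0..x} (\<lambda>t. f' (u t) * weak_deriv u t)" by simp
qed

lemma C1_primitive:
  fixes U :: "real \<Rightarrow> real"
  assumes "\<And>x. (U has_real_derivative U' x) (at x)" "0 \<le> x"
  shows "U x = U 0 + integral {0..x} U'"
proof -
  have "(U' has_integral U x - U 0) {0..x}"
    by (rule fundamental_theorem_of_calculus[OF assms(2)])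
      (simp add: has_real_derivative_iff_has_vector_derivative[symmetric] has_field_derivative_at_within[OF assms(1)])
  then show ?thesis by (simp add: integral_unique)
qed

section \<open>Comparison with a sign function\<close>

lemma sgn_measurable_unit_leb: "(\<lambda>x. s * sgn (x - c :: real)) \<in> borel_measurable unit_leb"
proof -
  have "(\<lambda>x. s * sgn (x - c)) = (\<lambda>x. if x < c then - s else if x = c then 0 else s)"
    by (auto simp: fun_eq_iff)
  moreover have "(\<lambda>x::real. if x < c then - s else if x = c then 0 else s) \<in> borel_measurable borel"
    by measurable
  ultimately have "(\<lambda>x. s * sgn (x - c)) \<in> borel_measurable borel" by simp
  then show ?thesis
    by (intro measurable_restrict_space1 measurable_completion) simp
qed

lemma L2_sgn: "(\<lambda>x. s * sgn (x - c :: real)) \<in> L2"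
  by (rule L2_bounded[OF sgn_measurable_unit_leb, of _ _ "\<bar>s\<bar>"]) (auto simp: abs_mult sgn_real_def)

lemma integral_sgn_shift_left:
  fixes r :: "real \<Rightarrow> real"
  shows "integral {a..c} (\<lambda>x. h (r x - s * sgn (x - c))) = integral {a..c} (\<lambda>x. h (r x + s))"
  by (rule integral_spike[of "{c}"]) auto

lemma integral_sgn_shift_right:
  fixes r :: "real \<Rightarrow> real"
  shows "integral {c..b} (\<lambda>x. h (r x - s * sgn (x - c))) = integral {c..b} (\<lambda>x. h (r x - s))"
  by (rule integral_spike[of "{c}"]) auto

lemma integral_square_add_const:
  fixes r :: "real \<Rightarrow> real"
  assumes "a \<le> b" "r integrable_on {a..b}" "(\<lambda>x. (r x)\<^sup>2) integrable_on {a..b}"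
  shows "integral {a..b} (\<lambda>x. (r x + s)\<^sup>2) = integral {a..b} (\<lambda>x. (r x)\<^sup>2) + 2 * s * integral {a..b} r + s\<^sup>2 * (b - a)"
proof -
  have "((\<lambda>x. (r x)\<^sup>2 + 2 * s * r x + s\<^sup>2) has_integral
      integral {a..b} (\<lambda>x. (r x)\<^sup>2) + 2 * s * integral {a..b} r + (b - a) *\<^sub>R s\<^sup>2) {a..b}"
    by (intro has_integral_add has_integral_mult_right integrable_integral assms
        has_integral_const_real[of _ a b, simplified content_real[OF assms(1)]])
  moreover have "(\<lambda>x. (r x)\<^sup>2 + 2 * s * r x + s\<^sup>2) = (\<lambda>x. (r x + s)\<^sup>2)"
    by (auto simp: fun_eq_iff power2_sum)
  ultimately show ?thesis by (simp add: integral_unique mult.commute)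
qed

text \<open>The sign is constant on each side of \<open>c\<close>, so the cross term integrates to
  increments of \<open>p\<close>. The point is left free since both the crossing point of
  \<open>u\<close> and \<open>xdag\<close> are inserted later.\<close>

lemma sgn_energy_identity:
  assumes p: "p \<in> H1_cont" and c: "0 \<le> c" "c \<le> 1"
  shows "(l2norm (\<lambda>x. weak_deriv p x - s * sgn (x - c)))\<^sup>2
    = (l2norm (weak_deriv p))\<^sup>2 - 2 * s * (p 0 + p 1 - 2 * p c) + s\<^sup>2"
proof -
  define r where "r = weak_deriv p"
  have r: "r \<in> L2" unfolding r_def by (rule weak_deriv_props(1)[OF p])
  define k where "k x = r x - s * sgn (x - c)" for x
  have k: "k \<in> L2" unfolding k_def by (rule L2_diff[OF r L2_sgn])
  have i: "r integrable_on {0..c}" "(\<lambda>x. (r x)\<^sup>2) integrable_on {0..c}" "r integrable_on {c..1}" "(\<lambda>x. (r x)\<^sup>2) integrable_on {c..1}"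
    using L2_integrable_on[OF r] c by auto
  have "integral {0..c} (\<lambda>x. (k x)\<^sup>2) = integral {0..c} (\<lambda>x. (r x)\<^sup>2) + 2 * s * (p c - p 0) + s\<^sup>2 * c"
    using integral_sgn_shift_left[of 0 c "\<lambda>x. x\<^sup>2" r s] integral_square_add_const[OF c(1) i(1,2), of s]
      H1_cont_increment[OF p, of 0 c] c by (simp add: k_def r_def)
  moreover have "integral {c..1} (\<lambda>x. (k x)\<^sup>2) = integral {c..1} (\<lambda>x. (r x)\<^sup>2) - 2 * s * (p 1 - p c) + s\<^sup>2 * (1 - c)"
    using integral_sgn_shift_right[of c 1 "\<lambda>x. x\<^sup>2" r s] integral_square_add_const[OF c(2) i(3,4), of "-s"]
      H1_cont_increment[OF p, of c 1] c by (simp add: k_def r_def)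
  moreover have "integral {0..c} (\<lambda>x. (k x)\<^sup>2) + integral {c..1} (\<lambda>x. (k x)\<^sup>2) = integral {0..1} (\<lambda>x. (k x)\<^sup>2)"
    using L2_integrable_on(2)[OF k, of 0 1] c by (intro Henstock_Kurzweil_Integration.integral_combine) auto
  moreover have "integral {0..c} (\<lambda>x. (r x)\<^sup>2) + integral {c..1} (\<lambda>x. (r x)\<^sup>2) = integral {0..1} (\<lambda>x. (r x)\<^sup>2)"
    using L2_integrable_on(2)[OF r, of 0 1] c by (intro Henstock_Kurzweil_Integration.integral_combine) auto
  ultimately have "(l2norm k)\<^sup>2 = (l2norm r)\<^sup>2 + 2 * s * (p c - p 0) + s\<^sup>2 * c - 2 * s * (p 1 - p c) + s\<^sup>2 * (1 - c)"
    by (simp add: l2norm_power2 k r)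
  also have "\<dots> = (l2norm r)\<^sup>2 - 2 * s * (p 0 + p 1 - 2 * p c) + s\<^sup>2" by (simp add: algebra_simps)
  finally show ?thesis by (simp add: k_def[abs_def] r_def)
qed

text \<open>Integrate the difference of the derivatives between \<open>c\<close> and
  \<open>x\<close>; by Cauchy-Schwarz on an interval of length at most 1, the norm bounds the
  result.\<close>

lemma sgn_profile_bound:
  assumes p: "p \<in> H1_cont" and c: "0 \<le> c" "c \<le> 1" and x: "0 \<le> x" "x \<le> 1"
  shows "\<bar>p x - p c - s * \<bar>x - c\<bar>\<bar> \<le> l2norm (\<lambda>x. weak_deriv p x - s * sgn (x - c))"
proof -
  define r where "r = weak_deriv p"
  have r: "r \<in> L2" unfolding r_def by (rule weak_deriv_props(1)[OF p])
  define k where "k x = r x - s * sgn (x - c)" for x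
  have k: "k \<in> L2" unfolding k_def by (rule L2_diff[OF r L2_sgn])
  have "\<bar>p x - p c - s * \<bar>x - c\<bar>\<bar> \<le> l2norm k"
  proof (cases "x \<le> c")
    case True
    have "integral {x..c} k = integral {x..c} (\<lambda>t. r t + s) "
      unfolding k_def by (rule integral_spike[of "{c}"]) auto
    also have "\<dots> = p c - p x + s * (c - x)"
      using H1_cont_increment[OF p x(1) True c(2)] L2_integrable_on(1)[OF r x(1) c(2)] True
      by (simp add: Henstock_Kurzweil_Integration.integral_add r_def integrable_const_ivl)
    finally show ?thesis using L2_integral_bound[OF k x(1) True c(2)] True by (simp add: algebra_simps)
  next
    case False
    then have cx: "c \<le> x" by simp
    have "integral {c..x} k = integral {c..x} (\<lambda>t. r t - s) "
      unfolding k_def by (rule integral_spike[of "{c}"]) auto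
    also have "\<dots> = p x - p c - s * (x - c)"
      using H1_cont_increment[OF p c(1) cx x(2)] L2_integrable_on(1)[OF r c(1) x(2)] cx
      by (simp add: Henstock_Kurzweil_Integration.integral_diff r_def integrable_const_ivl)
    finally show ?thesis using L2_integral_bound[OF k c(1) cx x(2)] cx by (simp add: algebra_simps)
  qed
  then show ?thesis by (simp add: k_def[abs_def] r_def)
qed

text \<open>A jump of a function must be matched by a jump of the primitive of its weak derivative.\<close>

lemma sgn_not_H1:
  assumes c: "0 < c" "c < 1" and s: "s > 0"
  shows "(\<lambda>x. s * sgn (x - c)) \<notin> H1"
proof
  define r where "r x = s * sgn (x - c)" for x
  assume "(\<lambda>x. s * sgn (x - c)) \<in> H1"
  then obtain g where g: "g \<in> L2" "has_weak_deriv r g" by (auto simp: H1_def r_def[abs_def])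
  have r2: "r \<in> L2" unfolding r_def by (rule L2_sgn)
  define G where "G x = integral {0..x} g" for x
  have Gc: "continuous_on {0..1} G" unfolding G_def
    by (intro indefinite_integral_continuous_1) (use L2_integrable_on(1)[OF g(1)] in auto)
  define w where "w x = r x - G x" for x
  have Gi: "isCont G x" if "0 < x" "x < 1" for x
    using continuous_on_interior[OF Gc, of x] that by simp
  have ri: "isCont r x" if "x \<noteq> c" for x
  proof -
    have "isCont (\<lambda>x. s * sgn (x - c)) x" using that by (intro continuous_intros) auto
    then show ?thesis by (simp add: r_def[abs_def])
  qed
  have jump: "w a = w b" if ab: "0 < a" "a < c" "c < b" "b < 1" for a b
  proof (rule du_Bois_Reymond[of w])
    show "w absolutely_integrable_on {0..1}" unfolding w_def
      by (rule L2_absolutely_integrable[OF L2_diff[OF r2 L2_continuous[OF Gc]]])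
    show "integral {0..1} (\<lambda>x. w x * deriv \<phi> x) = 0" if "\<phi> \<in> test_functions" for \<phi>
      unfolding w_def G_def by (rule weak_deriv_orthogonal[OF r2 g that])
    show "isCont w a" "isCont w b" unfolding w_def
      using ab by (auto intro!: continuous_intros Gi ri)
  qed (use ab c in auto)
  have "\<forall>\<^sub>F x in at c. dist (G x) (G c) < s"
    using Gi[OF c] s unfolding isCont_def by (rule tendstoD)
  then obtain d where d: "d > 0" "\<And>x. x \<noteq> c \<Longrightarrow> dist x c < d \<Longrightarrow> dist (G x) (G c) < s"
    unfolding eventually_at by auto
  define t where "t = min (d / 2) (min (c / 2) ((1 - c) / 2))"
  have t: "t > 0" "t \<le> d / 2" "t \<le> c / 2" "t \<le> (1 - c) / 2" using d(1) c unfolding t_def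
    by (simp_all only: min_less_iff_conj min_le_iff_disj) auto
  have "dist (G (c - t)) (G c) < s" "dist (G (c + t)) (G c) < s"
    using d t by (auto simp: dist_real_def)
  \<comment> \<open>Equality of \<open>w\<close> across \<open>c\<close> makes \<open>G\<close> rise
    by the jump \<open>2 * s\<close> of \<open>r\<close>, although it moves by less than
    \<open>s\<close> on either side.\<close>
  moreover have "w (c - t) = w (c + t)" using t c by (intro jump) auto
  then have "G (c + t) - G (c - t) = 2 * s" using t(1) by (simp add: w_def r_def)
  ultimately show False by (simp add: dist_real_def)
qed

section \<open>Convex flux functions\<close>

locale convex_flux =
  fixes f f' f'' :: "real \<Rightarrow> real" and us :: real
  assumes f_deriv: "\<And>z. (f has_real_derivative f' z) (at z)"
    and f_deriv2: "\<And>z. (f' has_real_derivative f'' z) (at z)"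
    and f_C2: "continuous_on UNIV f''"
    and f_convex: "\<And>z. f'' z > 0"
    and us_min: "\<And>z. f us \<le> f z"
    and f_us: "f us = 0"
begin

lemma f'_us: "f' us = 0"
  by (rule DERIV_local_min[OF f_deriv, of 1]) (auto intro: us_min)

lemma f'_less: "a < b \<Longrightarrow> f' a < f' b"
  by (rule DERIV_pos_imp_increasing) (use f_deriv2 f_convex in blast)+

lemma f'_mono: "a \<le> b \<Longrightarrow> f' a \<le> f' b"
  using f'_less[of a b] by (cases "a = b") auto

lemma f'_pos: "us < z \<Longrightarrow> f' z > 0" and f'_neg: "z < us \<Longrightarrow> f' z < 0"
  using f'_less[of us z] f'_less[of z us] f'_us by auto

lemma f'_cont: "continuous_on S f'"
  by (rule DERIV_continuous_on[where D = f'']) (rule has_field_derivative_at_within[OF f_deriv2])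

lemma f_cont: "continuous_on S f"
  by (rule DERIV_continuous_on[where D = f']) (rule has_field_derivative_at_within[OF f_deriv])

lemma f_nonneg: "f z \<ge> 0"
  using us_min[of z] f_us by simp

lemma f_mono_right: assumes "us \<le> a" "a < b" shows "f a < f b"
proof -
  obtain z where "a < z" "z < b" "f b - f a = (b - a) * f' z"
    using MVT2[OF assms(2), of f f'] f_deriv by blast
  then show ?thesis using f'_pos[of z] assms mult_pos_pos[of "b - a" "f' z"] by linarith
qed

lemma f_mono_left: assumes "a < b" "b \<le> us" shows "f b < f a"
proof -
  obtain z where "a < z" "z < b" "f b - f a = (b - a) * f' z"
    using MVT2[OF assms(1), of f f'] f_deriv by blast
  then show ?thesis using f'_neg[of z] assms mult_pos_neg[of "b - a" "f' z"] by linarith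
qed

lemma f_pos: "z \<noteq> us \<Longrightarrow> f z > 0"
  using f_mono_right[of us z] f_mono_left[of z us] f_us by (cases z us rule: linorder_cases) auto

lemma f_mono_right_le: "us \<le> a \<Longrightarrow> a \<le> b \<Longrightarrow> f a \<le> f b"
  using f_mono_right[of a b] by (cases "a = b") auto

lemma f_mono_left_le: "a \<le> b \<Longrightarrow> b \<le> us \<Longrightarrow> f b \<le> f a"
  using f_mono_left[of a b] by (cases "a = b") auto

text \<open>The increment over a fixed length has derivative \<open>f' (x + c) - f' x\<close>, which
  is nonnegative because \<open>f'\<close> increases.\<close>

lemma f_shift_increment_mono:
  assumes "a \<le> b" "0 \<le> c"
  shows "f (a + c) - f a \<le> f (b + c) - f b"
proof (rule DERIV_nonneg_imp_nondecreasing[OF assms(1)])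
  fix x
  have "((\<lambda>x. f (x + c) - f x) has_real_derivative f' (x + c) - f' x) (at x)"
    using DERIV_diff[OF iffD1[OF DERIV_shift f_deriv[of "x + c"]] f_deriv[of x]] .
  then show "\<exists>y. ((\<lambda>x. f (x + c) - f x) has_real_derivative y) (at x) \<and> 0 \<le> y"
    using f'_mono[of x "x + c"] assms(2) by auto
qed

text \<open>A modulus of continuity, read backwards, that serves both inverse branches of
  \<open>f\<close>: on one branch, values closer than this come from arguments closer than
  \<open>e\<close>.\<close>

definition well_height :: "real \<Rightarrow> real" where
  "well_height e = min (f (us + e)) (f (us - e))"

lemma well_height_pos: "e > 0 \<Longrightarrow> well_height e > 0"
  by (simp add: well_height_def f_pos)

text \<open>By convexity the increments of \<open>f\<close> are smallest at its minimizer.\<close>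

lemma branch_close:
  assumes "e > 0" and side: "us \<le> z \<and> us \<le> w \<or> z \<le> us \<and> w \<le> us"
    and close: "\<bar>f z - f w\<bar> < well_height e"
  shows "\<bar>z - w\<bar> < e"
proof -
  have *: "b - a < e" if ab: "a \<le> b" "us \<le> a \<or> b \<le> us" and c: "\<bar>f b - f a\<bar> < well_height e" for a b
  proof (rule ccontr)
    assume n: "\<not> b - a < e"
    from ab(2) show False
    proof
      assume "us \<le> a"
      have "f (us + (b - a)) \<le> f b - f a"
        using f_shift_increment_mono[OF \<open>us \<le> a\<close>, of "b - a"] ab(1) f_us by simp
      moreover have "f (us + e) \<le> f (us + (b - a))"
        by (rule f_mono_right_le) (use n \<open>e > 0\<close> in auto)
      ultimately show False using c unfolding well_height_def by linarith
    next
      assume "b \<le> us"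
      \<comment> \<open>On the left branch the interval is slid to the right until it ends at
        \<open>us\<close>, where the drop of \<open>f\<close> is smallest.\<close>
      have "f us - f (us - (b - a)) \<ge> f b - f a"
        using f_shift_increment_mono[of a "us - (b - a)" "b - a"] ab(1) \<open>b \<le> us\<close> by simp
      moreover have "f (us - e) \<le> f (us - (b - a))"
        by (rule f_mono_left_le) (use n \<open>e > 0\<close> in auto)
      ultimately show False using c f_us unfolding well_height_def by linarith
    qed
  qed
  show ?thesis using *[of z w] *[of w z] side close by (cases "z \<le> w") (auto simp: abs_minus_commute)
qed

text \<open>The point \<open>us\<close> belongs to both branches, so it can be compared with
  \<open>z\<close> on either side.\<close>

lemma near_minimizer: "e > 0 \<Longrightarrow> f z < well_height e \<Longrightarrow> \<bar>z - us\<bar> < e"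
  using branch_close[of e z us] f_us f_nonneg[of z] linear[of us z] by auto

lemma flux_H1_cont: "u \<in> H1_cont \<Longrightarrow> (\<lambda>y. f (u y)) \<in> H1_cont"
  by (rule H1_cont_comp[OF _ f_deriv f'_cont])

lemma J0_eq: "u \<in> H1_cont \<Longrightarrow> J0 f u = 1 / 2 * (l2norm (weak_deriv (\<lambda>y. f (u y))))\<^sup>2"
  by (simp add: J0_def l2norm_def real_sqrt_pow2)

text \<open>The signed flux. Reflecting the left branch makes \<open>f\<close> increasing, and the
  reflection produces no kink because \<open>f'\<close> vanishes at \<open>us\<close>.\<close>

definition folded :: "real \<Rightarrow> real" where
  "folded z = (if us \<le> z then f z else - f z)"

lemma folded_deriv: "(folded has_real_derivative \<bar>f' z\<bar>) (at z)"
proof (cases z us rule: linorder_cases)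
  case less
  have "((\<lambda>z. - f z) has_real_derivative - f' z) (at z)" by (rule DERIV_minus[OF f_deriv])
  then have "(folded has_real_derivative - f' z) (at z)"
    by (rule has_field_derivative_transform_within_open[of _ _ _ "{..<us}"]) (use less in \<open>auto simp: folded_def\<close>)
  then show ?thesis using f'_neg[OF less] by simp
next
  case greater
  have "(folded has_real_derivative f' z) (at z)"
    by (rule has_field_derivative_transform_within_open[OF f_deriv[of z], of "{us<..}"]) (use greater in \<open>auto simp: folded_def\<close>)
  then show ?thesis using f'_pos[OF greater] by simp
next
  case equal
  have "(\<lambda>h. (f (us + h) - f us) / h) \<midarrow>0\<rightarrow> 0"
    using f_deriv[of us] f'_us by (simp add: DERIV_def)
  then have "(\<lambda>h. \<bar>(f (us + h) - f us) / h\<bar>) \<midarrow>0\<rightarrow> 0" by (simp only: tendsto_rabs_zero_iff)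
  \<comment> \<open>At \<open>us\<close> the difference quotients of \<open>f\<close> and
    \<open>folded\<close> agree in absolute value, so they tend to 0 together.\<close>
  moreover have "(\<lambda>h. \<bar>(f (us + h) - f us) / h\<bar>) = (\<lambda>h. \<bar>(folded (us + h) - folded us) / h\<bar>)"
    by (auto simp: fun_eq_iff folded_def f_us)
  ultimately have "(\<lambda>h. (folded (us + h) - folded us) / h) \<midarrow>0\<rightarrow> 0" by (simp only: tendsto_rabs_zero_iff)
  then show ?thesis using equal f'_us by (simp add: DERIV_def)
qed

text \<open>Choose \<open>u\<close> so that \<open>folded (u x) + e * (u x - us)\<close> is affine in \<open>x\<close>.\<close>

lemma almost_optimal:
  assumes ul: "ur < us" "us < ul" and e: "e > 0"
  shows "\<exists>u\<in>admissible ul ur. J0 f u \<le> 1 / 2 * (f ul + f ur + e * (ul - ur))\<^sup>2"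
proof -
  \<comment> \<open>The term with \<open>e\<close> keeps the derivative positive at
    \<open>us\<close>, where that of \<open>folded\<close> is 0; this makes the inverse
    differentiable.\<close>
  define \<Phi> where "\<Phi> z = folded z + e * (z - us)" for z
  define \<Phi>' where "\<Phi>' z = \<bar>f' z\<bar> + e" for z
  have der: "(\<Phi> has_real_derivative \<Phi>' z) (at z)" for z
    unfolding \<Phi>_def \<Phi>'_def
    by (rule DERIV_add[OF folded_deriv]) (auto intro!: derivative_eq_intros)
  have pos: "\<Phi>' z > 0" for z using e by (simp add: \<Phi>'_def add_nonneg_pos)
  have cont: "isCont \<Phi> z" for z by (rule DERIV_isCont[OF der])
  have less: "\<Phi> a < \<Phi> b" if "a < b" for a b
    by (rule DERIV_pos_imp_increasing[OF that]) (use der pos in blast)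
  have inj: "inj \<Phi>"
    by (rule injI) (metis less less_irrefl linorder_neqE)
  have surj: "\<exists>z. \<Phi> z = y" for y
  proof -
    \<comment> \<open>At distance \<open>t\<close> from \<open>us\<close> the linear term alone
      reaches \<open>\<bar>y\<bar>\<close>, and \<open>folded\<close> has the same sign there, so
      \<open>y\<close> is bracketed.\<close>
    define t where "t = \<bar>y\<bar> / e"
    have t: "t \<ge> 0" "e * t = \<bar>y\<bar>" using e by (auto simp: t_def)
    have 1: "\<Phi> (us - t) \<le> y" using t f_nonneg[of "us - t"] f_us by (auto simp: \<Phi>_def folded_def)
    have 2: "y \<le> \<Phi> (us + t)" using t f_nonneg[of "us + t"] by (auto simp: \<Phi>_def folded_def)
    show ?thesis using IVT[of \<Phi>, OF 1 2] cont t(1) by auto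
  qed
  define g where "g = inv \<Phi>"
  have g\<Phi>: "g (\<Phi> z) = z" for z using inj by (simp add: g_def)
  have \<Phi>g: "\<Phi> (g y) = y" for y using surj[of y] g\<Phi> by force
  have gc: "isCont g y" for y
    using isCont_inverse_function[of 1 "g y" g \<Phi>] g\<Phi> cont \<Phi>g[of y] by simp
  have gd: "(g has_real_derivative inverse (\<Phi>' (g y))) (at y)" for y
    by (rule DERIV_inverse_function[OF der _ _ _ _ gc, of _ "y - 1" "y + 1"]) (use pos[of "g y"] \<Phi>g in auto)
  define L where "L = \<Phi> ul - \<Phi> ur"
  have L: "L = f ul + f ur + e * (ul - ur)"
    using ul by (simp add: L_def \<Phi>_def folded_def algebra_simps)
  have Lpos: "L > 0" unfolding L_def using less[of ur ul] ul by simp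
  define u where "u x = g (\<Phi> ul - L * x)" for x
  have ud: "(u has_real_derivative inverse (\<Phi>' (u x)) * (- L)) (at x)" for x
    unfolding u_def by (rule DERIV_chain2[OF gd]) (auto intro!: derivative_eq_intros)
  have uc: "continuous_on S u" for S
    by (rule DERIV_continuous_on) (rule has_field_derivative_at_within[OF ud])
  have f'u: "continuous_on S (\<lambda>x. f' (u x))" for S
    by (rule continuous_on_compose2[OF f'_cont[of UNIV] uc]) auto
  have u'c: "continuous_on S (\<lambda>x. inverse (\<Phi>' (u x)) * (- L))" for S
  proof -
    have "\<Phi>' (u x) \<noteq> 0" for x using pos[of "u x"] by simp
    moreover have "continuous_on S (\<lambda>x. \<Phi>' (u x))" unfolding \<Phi>'_def by (intro continuous_intros f'u)
    ultimately show ?thesis by (intro continuous_intros) auto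
  qed
  have uH: "u \<in> H1_cont"
    by (rule H1_contI_primitive[OF L2_continuous[OF u'c] C1_primitive[OF ud]]) auto
  have "u 0 = ul" "u 1 = ur" using g\<Phi> by (simp_all add: u_def L_def)
  then have adm: "u \<in> admissible ul ur" using uH by (simp add: admissible_def)
  define q where "q x = f' (u x) * (inverse (\<Phi>' (u x)) * (- L))" for x
  have q2: "q \<in> L2" unfolding q_def by (intro L2_continuous continuous_on_mult f'u u'c)
  have "((\<lambda>x. f (u x)) has_real_derivative q x) (at x)" for x
    unfolding q_def by (rule DERIV_chain2[OF f_deriv ud])
  then have "l2norm (weak_deriv (\<lambda>x. f (u x))) = l2norm q"
    by (intro l2norm_weak_deriv_eq[OF q2] C1_primitive) auto
  then have "J0 f u = 1 / 2 * integral {0..1} (\<lambda>x. (q x)\<^sup>2)"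
    using J0_eq[OF uH] l2norm_power2[OF q2] by simp
  moreover have "integral {0..1} (\<lambda>x. (q x)\<^sup>2) \<le> integral {0..1::real} (\<lambda>x. L\<^sup>2)"
  proof (rule integral_le)
    show "(\<lambda>x. (q x)\<^sup>2) integrable_on {0..1}" using L2_integrable_on(2)[OF q2, of 0 1] by simp
    fix x
    \<comment> \<open>The flux derivative is \<open>- L\<close> times
      \<open>f' / (\<bar>f'\<bar> + e)\<close>, a factor of modulus at most 1, so its size never
      exceeds \<open>L\<close>.\<close>
    have "\<bar>f' (u x)\<bar> * inverse (\<Phi>' (u x)) \<le> 1"
      using pos[of "u x"] e by (simp add: \<Phi>'_def field_simps)
    then have "\<bar>f' (u x)\<bar> * inverse (\<Phi>' (u x)) * L \<le> 1 * L"
      using Lpos by (intro mult_right_mono) auto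
    then have "\<bar>q x\<bar> \<le> \<bar>L\<bar>" using Lpos pos[of "u x"] by (simp add: q_def abs_mult mult.assoc)
    then show "(q x)\<^sup>2 \<le> L\<^sup>2" by (simp only: abs_le_square_iff)
  qed (rule integrable_const_ivl)
  ultimately have "J0 f u \<le> 1 / 2 * L\<^sup>2" by simp
  then show ?thesis using adm L by blast
qed

end

section \<open>Minimizing sequences\<close>

text \<open>By Cauchy-Schwarz each quotient is at most the energy on its own interval, and the
  intervals do not overlap. The points decrease because they will accumulate at \<open>xdag\<close>
  from the right.\<close>

lemma H1_cont_sum_increments_le:
  fixes x :: "nat \<Rightarrow> real"
  assumes v: "v \<in> H1_cont" and x: "\<And>k. x (Suc k) < x k" "\<And>k. 0 \<le> x k" "x 0 \<le> 1"
  shows "(\<Sum>k<K. (v (x k) - v (x (Suc k)))\<^sup>2 / (x k - x (Suc k))) \<le> (l2norm (weak_deriv v))\<^sup>2"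
proof -
  define g where "g = weak_deriv v"
  have g: "g \<in> L2" unfolding g_def by (rule weak_deriv_props(1)[OF v])
  have "x k \<le> x 0" for k by (rule lift_Suc_antimono_le[of x]) (use x(1) less_imp_le in auto)
  then have x1: "x k \<le> 1" for k using x(3) order_trans by blast
  have "(\<Sum>k<K. (v (x k) - v (x (Suc k)))\<^sup>2 / (x k - x (Suc k))) \<le> integral {x K..x 0} (\<lambda>t. (g t)\<^sup>2)"
  proof (induction K)
    case (Suc K)
    have "(v (x K) - v (x (Suc K)))\<^sup>2 \<le> (x K - x (Suc K)) * integral {x (Suc K)..x K} (\<lambda>t. (g t)\<^sup>2)"
      using Cauchy_Schwarz_interval[of "x (Suc K)" "x K" g] L2_integrable_on[OF g x(2) x1]
        H1_cont_increment[OF v x(2), of "Suc K" "x K"] x1[of K] x(1)[of K] by (simp add: g_def)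
    then have "(v (x K) - v (x (Suc K)))\<^sup>2 / (x K - x (Suc K)) \<le> integral {x (Suc K)..x K} (\<lambda>t. (g t)\<^sup>2)"
      using x(1)[of K] by (simp add: pos_divide_le_eq mult.commute)
    moreover have "x K \<le> x 0" by (rule lift_Suc_antimono_le[of x]) (use x(1) less_imp_le in auto)
    then have "integral {x (Suc K)..x K} (\<lambda>t. (g t)\<^sup>2) + integral {x K..x 0} (\<lambda>t. (g t)\<^sup>2) = integral {x (Suc K)..x 0} (\<lambda>t. (g t)\<^sup>2)"
      using x(1)[of K] L2_integrable_on(2)[OF g x(2) x1] by (intro Henstock_Kurzweil_Integration.integral_combine) auto
    ultimately show ?case using Suc by simp
  qed simp
  also have "\<dots> \<le> (l2norm g)\<^sup>2"
    using L2_subinterval_square_le[OF g x(2) x1] by (simp add: l2norm_power2 g)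
  finally show ?thesis by (simp add: g_def)
qed

locale singular_minimization = convex_flux +
  fixes ul ur s xdag :: real and udag :: "real \<Rightarrow> real"
  assumes ur_us: "ur < us" and us_ul: "us < ul"
    and s_eq: "s = f ul + f ur"
    and xdag_eq: "xdag = f ul / s"
    and udag_eq: "udag = (\<lambda>x. if x \<le> xdag then inv_into {us..} f (s * \<bar>x - xdag\<bar>)
                                else inv_into {..us} f (s * \<bar>x - xdag\<bar>))"
begin

section \<open>The limit profile and its flux\<close>

lemma f_ul: "f ul > 0" and f_ur: "f ur > 0"
  using f_pos ur_us us_ul by auto

lemma s_pos: "s > 0"
  using f_ul f_ur s_eq by simp

lemma s_xdag: "s * xdag = f ul" "s * (1 - xdag) = f ur"
  using s_pos by (simp_all add: xdag_eq right_diff_distrib) (simp add: s_eq)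

lemma xdag: "0 < xdag" "xdag < 1"
  using f_ul f_ur by (simp_all add: xdag_eq s_eq add_pos_pos)

lemma udag_left:
  assumes "0 \<le> x" "x \<le> xdag"
  shows "us \<le> udag x" "f (udag x) = s * \<bar>x - xdag\<bar>"
proof -
  have "s * \<bar>x - xdag\<bar> \<le> s * xdag" using assms s_pos by (intro mult_left_mono) auto
  \<comment> \<open>The value of \<open>inv_into\<close> is meaningful only on the range of the
    branch. The largest value required is \<open>s * xdag = f ul\<close>, so the intermediate value
    theorem applies.\<close>
  then have "\<exists>z\<ge>us. z \<le> ul \<and> f z = s * \<bar>x - xdag\<bar>"
    using s_pos us_ul f_us s_xdag(1) by (intro IVT' f_cont) auto
  then have "s * \<bar>x - xdag\<bar> \<in> f ` {us..}" by force
  then show "us \<le> udag x" "f (udag x) = s * \<bar>x - xdag\<bar>"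
    using inv_into_into[of _ f "{us..}"] f_inv_into_f[of _ f "{us..}"] assms by (auto simp: udag_eq)
qed

lemma udag_right:
  assumes "xdag \<le> x" "x \<le> 1"
  shows "udag x \<le> us" "f (udag x) = s * \<bar>x - xdag\<bar>"
proof -
  have "udag x \<le> us \<and> f (udag x) = s * \<bar>x - xdag\<bar>"
  proof (cases "x = xdag")
    \<comment> \<open>At \<open>xdag\<close> the definition uses the other branch, but zero flux
      occurs only at \<open>us\<close>, which both branches share.\<close>
    case True
    then have "f (udag x) = 0" using udag_left[of x] xdag by simp
    then show ?thesis using True f_pos[of "udag x"] by force
  next
    case False
    have "s * \<bar>x - xdag\<bar> \<le> s * (1 - xdag)" using assms s_pos by (intro mult_left_mono) auto
    then have "\<exists>z\<ge>ur. z \<le> us \<and> f z = s * \<bar>x - xdag\<bar>"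
      using s_pos ur_us f_us s_xdag(2) by (intro IVT2' f_cont) auto
    then have "s * \<bar>x - xdag\<bar> \<in> f ` {..us}" by force
    then show ?thesis
      using inv_into_into[of _ f "{..us}"] f_inv_into_f[of _ f "{..us}"] assms False by (auto simp: udag_eq)
  qed
  then show "udag x \<le> us" "f (udag x) = s * \<bar>x - xdag\<bar>" by auto
qed

lemma f_udag: "0 \<le> x \<Longrightarrow> x \<le> 1 \<Longrightarrow> f (udag x) = s * \<bar>x - xdag\<bar>"
  using udag_left(2)[of x] udag_right(2)[of x] by linarith

section \<open>The sharp lower bound and the infimum\<close>

lemma admissibleD:
  assumes "u \<in> admissible ul ur"
  shows "u \<in> H1_cont" "u 0 = ul" "u 1 = ur" "continuous_on {0..1} u"
  using assms by (auto simp: admissible_def H1_cont_def)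

lemma admissible_zero:
  assumes "u \<in> admissible ul ur"
  shows "\<exists>c. 0 \<le> c \<and> c \<le> 1 \<and> u c = us"
  using admissibleD[OF assms] ur_us us_ul by (intro IVT2') auto

text \<open>The boundary values of the flux add up to \<open>s\<close>, so the cross term becomes
  \<open>4 * s * f (u c)\<close> minus twice the square of \<open>s\<close>. At a crossing point
  \<open>f (u c)\<close> vanishes, leaving exactly the energy excess.\<close>

lemma energy_excess:
  assumes u: "u \<in> admissible ul ur" and c: "0 \<le> c" "c \<le> 1"
  shows "(l2norm (\<lambda>x. weak_deriv (\<lambda>y. f (u y)) x - s * sgn (x - c)))\<^sup>2
    = 2 * J0 f u - s\<^sup>2 + 4 * s * f (u c)"
  using sgn_energy_identity[OF flux_H1_cont[OF admissibleD(1)[OF u]] c, of s] J0_eq[OF admissibleD(1)[OF u]]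
    admissibleD[OF u] by (simp add: s_eq power2_eq_square algebra_simps)

lemma J0_ge:
  assumes "u \<in> admissible ul ur"
  shows "1 / 2 * s\<^sup>2 \<le> J0 f u"
proof -
  obtain c where c: "0 \<le> c" "c \<le> 1" "u c = us" using admissible_zero[OF assms] by blast
  have "0 \<le> (l2norm (\<lambda>x. weak_deriv (\<lambda>y. f (u y)) x - s * sgn (x - c)))\<^sup>2" by simp
  then show ?thesis unfolding energy_excess[OF assms c(1,2)] using c f_us by simp
qed

lemma minimizing_exists:
  "\<exists>U. (\<forall>n. U n \<in> admissible ul ur) \<and> (\<lambda>n. J0 f (U n)) \<longlonglongrightarrow> 1 / 2 * s\<^sup>2"
proof -
  have "\<exists>u\<in>admissible ul ur. J0 f u \<le> 1 / 2 * (f ul + f ur + inverse (real (Suc n)) * (ul - ur))\<^sup>2" for n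
    by (rule almost_optimal[OF ur_us us_ul]) simp
  then obtain U where U: "\<And>n. U n \<in> admissible ul ur"
    "\<And>n. J0 f (U n) \<le> 1 / 2 * (f ul + f ur + inverse (real (Suc n)) * (ul - ur))\<^sup>2" by metis
  have "(\<lambda>n. 1 / 2 * (f ul + f ur + inverse (real (Suc n)) * (ul - ur))\<^sup>2) \<longlonglongrightarrow> 1 / 2 * (f ul + f ur + 0 * (ul - ur))\<^sup>2"
    by (intro tendsto_intros LIMSEQ_inverse_real_of_nat)
  then have lim: "(\<lambda>n. 1 / 2 * (f ul + f ur + inverse (real (Suc n)) * (ul - ur))\<^sup>2) \<longlonglongrightarrow> 1 / 2 * s\<^sup>2"
    by (simp add: s_eq)
  have "(\<lambda>n. J0 f (U n)) \<longlonglongrightarrow> 1 / 2 * s\<^sup>2"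
    by (rule tendsto_sandwich[OF _ _ tendsto_const lim]) (use U J0_ge in auto)
  then show ?thesis using U(1) by blast
qed

lemma INF_J0: "(INF u\<in>admissible ul ur. J0 f u) = 1 / 2 * s\<^sup>2"
proof (rule antisym)
  obtain U where U: "\<And>n. U n \<in> admissible ul ur" "(\<lambda>n. J0 f (U n)) \<longlonglongrightarrow> 1 / 2 * s\<^sup>2"
    using minimizing_exists by blast
  have "bdd_below (J0 f ` admissible ul ur)" using J0_ge by (rule bdd_belowI2)
  then have "(INF u\<in>admissible ul ur. J0 f u) \<le> J0 f (U n)" for n using U(1) by (rule cINF_lower)
  then show "(INF u\<in>admissible ul ur. J0 f u) \<le> 1 / 2 * s\<^sup>2"
    by (intro LIMSEQ_le_const[OF U(2)]) auto
  show "1 / 2 * s\<^sup>2 \<le> (INF u\<in>admissible ul ur. J0 f u)"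
    by (rule cINF_greatest) (use U(1) J0_ge in auto)
qed

text \<open>The factor 2 collects two errors of size \<open>d\<close>: the displacement
  \<open>s * \<bar>xdag - c\<bar>\<close> of the crossing point, and the profile error at
  \<open>xdag\<close>.\<close>

lemma crossing_defect:
  assumes u: "u \<in> admissible ul ur"
  shows "f (u xdag) \<le> 2 * sqrt (2 * J0 f u - s\<^sup>2)"
proof -
  obtain c where c: "0 \<le> c" "c \<le> 1" "u c = us" using admissible_zero[OF u] by blast
  define d where "d = sqrt (2 * J0 f u - s\<^sup>2)"
  have "sqrt ((l2norm (\<lambda>x. weak_deriv (\<lambda>y. f (u y)) x - s * sgn (x - c)))\<^sup>2) = d"
    unfolding energy_excess[OF u c(1,2)] using c f_us by (simp add: d_def)
  then have d: "l2norm (\<lambda>x. weak_deriv (\<lambda>y. f (u y)) x - s * sgn (x - c)) = d" by simp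
  have b: "\<bar>f (u x) - s * \<bar>x - c\<bar>\<bar> \<le> d" if "0 \<le> x" "x \<le> 1" for x
    using sgn_profile_bound[OF flux_H1_cont[OF admissibleD(1)[OF u]] c(1,2) that, of s] d c(3) f_us by simp
  \<comment> \<open>The flux at 0 is known to be \<open>s * xdag\<close>; comparing it with the
    profile there locates \<open>c\<close>.\<close>
  have "s * \<bar>xdag - c\<bar> = \<bar>s * xdag - s * c\<bar>"
    using s_pos by (simp add: right_diff_distrib[symmetric] abs_mult)
  also have "\<dots> = \<bar>f (u 0) - s * \<bar>0 - c\<bar>\<bar>" using s_xdag(1) admissibleD(2)[OF u] c(1) by simp
  also have "\<dots> \<le> d" by (rule b) auto
  finally show ?thesis using b[of xdag] xdag by (simp add: d_def)
qed

section \<open>Convergence along a minimizing sequence\<close>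

context
  fixes U :: "nat \<Rightarrow> real \<Rightarrow> real"
  assumes U: "\<And>n. U n \<in> admissible ul ur" and lim: "(\<lambda>n. J0 f (U n)) \<longlonglongrightarrow> 1 / 2 * s\<^sup>2"
begin

lemma excess_tendsto: "(\<lambda>n. sqrt (2 * J0 f (U n) - s\<^sup>2)) \<longlonglongrightarrow> 0"
proof -
  have "(\<lambda>n. sqrt (2 * J0 f (U n) - s\<^sup>2)) \<longlonglongrightarrow> sqrt (2 * (1 / 2 * s\<^sup>2) - s\<^sup>2)"
    by (intro tendsto_intros lim)
  then show ?thesis by simp
qed

lemma flux_crossing_tendsto: "(\<lambda>n. f (U n xdag)) \<longlonglongrightarrow> 0"
proof (rule tendsto_sandwich[OF _ _ tendsto_const])
  show "(\<lambda>n. 2 * sqrt (2 * J0 f (U n) - s\<^sup>2)) \<longlonglongrightarrow> 0"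
    using tendsto_mult_right_zero[OF excess_tendsto] .
qed (use crossing_defect[OF U] f_nonneg in auto)

text \<open>The energy identity is used once more with the fixed point \<open>xdag\<close> in place
  of the moving crossing point; its extra term tends to 0.\<close>

lemma flux_derivative_tendsto:
  "(\<lambda>n. l2norm (\<lambda>x. weak_deriv (\<lambda>y. f (U n y)) x - s * sgn (x - xdag))) \<longlonglongrightarrow> 0"
proof -
  have "(\<lambda>n. 2 * J0 f (U n) - s\<^sup>2 + 4 * s * f (U n xdag)) \<longlonglongrightarrow> 2 * (1 / 2 * s\<^sup>2) - s\<^sup>2 + 4 * s * 0"
    by (intro tendsto_intros lim flux_crossing_tendsto)
  then have "(\<lambda>n. (l2norm (\<lambda>x. weak_deriv (\<lambda>y. f (U n y)) x - s * sgn (x - xdag)))\<^sup>2) \<longlonglongrightarrow> 0"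
    using energy_excess[OF U] xdag by simp
  then have "(\<lambda>n. sqrt ((l2norm (\<lambda>x. weak_deriv (\<lambda>y. f (U n y)) x - s * sgn (x - xdag)))\<^sup>2)) \<longlonglongrightarrow> sqrt 0"
    by (rule tendsto_real_sqrt)
  then show ?thesis by simp
qed

lemma minimizing_uniform_limit: "uniform_limit {0..1} U udag sequentially"
  unfolding uniform_limit_iff
proof (intro allI impI)
  fix e :: real assume e: "e > 0"
  define m where "m = well_height (e / 2)"
  have m: "m > 0" using e by (simp add: m_def well_height_pos)
  \<comment> \<open>The profile bound controls the flux relative to its value at
    \<open>xdag\<close>, so that value is added to obtain a uniform error.\<close>
  define \<eta> where "\<eta> n = l2norm (\<lambda>x. weak_deriv (\<lambda>y. f (U n y)) x - s * sgn (x - xdag)) + f (U n xdag)" for n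
  have "\<eta> \<longlonglongrightarrow> 0 + 0"
    unfolding \<eta>_def by (intro tendsto_intros flux_derivative_tendsto flux_crossing_tendsto)
  then have "\<forall>\<^sub>F n in sequentially. \<eta> n < m / 2"
    using m by (intro order_tendstoD(2)) auto
  then show "\<forall>\<^sub>F n in sequentially. \<forall>x\<in>{0..1}. dist (U n x) (udag x) < e"
  proof eventually_elim
    case (elim n)
    note uD = admissibleD[OF U[of n]]
    have b: "\<bar>f (U n x) - s * \<bar>x - xdag\<bar>\<bar> \<le> \<eta> n" if "0 \<le> x" "x \<le> 1" for x
      using sgn_profile_bound[OF flux_H1_cont[OF uD(1)] _ _ that, of xdag s] xdag f_nonneg[of "U n xdag"]
      by (simp add: \<eta>_def)
    show ?case
    proof
      fix x :: real assume "x \<in> {0..1}"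
      then have x: "0 \<le> x" "x \<le> 1" by auto
      show "dist (U n x) (udag x) < e"
      proof (cases "s * \<bar>x - xdag\<bar> < m / 2")
        case True
        then have "f (U n x) < m" "f (udag x) < m" using b[OF x] elim f_udag[OF x] m by auto
        then have "\<bar>U n x - us\<bar> < e / 2" "\<bar>udag x - us\<bar> < e / 2"
          using near_minimizer[of "e / 2"] e by (auto simp: m_def)
        then show ?thesis unfolding dist_real_def by linarith
      next
        case far: False
        \<comment> \<open>Farther from \<open>xdag\<close> the target flux is at least as large as
          at \<open>x\<close>, so the error \<open>\<eta> n\<close> leaves no room for zero flux.
          Hence \<open>U n\<close> does not cross \<open>us\<close> between \<open>x\<close> and the
          boundary point on its side, whose value fixes the branch.\<close>
        have away: "U n y \<noteq> us" if "0 \<le> y" "y \<le> 1" "\<bar>y - xdag\<bar> \<ge> \<bar>x - xdag\<bar>" for y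
        proof
          assume "U n y = us"
          then have "s * \<bar>y - xdag\<bar> \<le> \<eta> n" using b[OF that(1,2)] f_us by simp
          moreover have "s * \<bar>x - xdag\<bar> \<le> s * \<bar>y - xdag\<bar>" using that(3) s_pos by (intro mult_left_mono) auto
          ultimately show False using far elim by simp
        qed
        have "us \<le> U n x \<and> us \<le> udag x \<or> U n x \<le> us \<and> udag x \<le> us"
        proof (cases "x \<le> xdag")
          case True
          have "us \<le> U n x"
          proof (rule ccontr)
            assume "\<not> us \<le> U n x"
            then have "\<exists>y\<ge>0. y \<le> x \<and> U n y = us"
              using uD(2) us_ul x by (intro IVT2' continuous_on_subset[OF uD(4)]) auto
            then obtain y where "0 \<le> y" "y \<le> x" "U n y = us" by blast
            then show False using away[of y] True x by simp
          qed
          then show ?thesis using udag_left(1)[OF x(1) True] by simp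
        next
          case False
          have "U n x \<le> us"
          proof (rule ccontr)
            assume "\<not> U n x \<le> us"
            then have "\<exists>y\<ge>x. y \<le> 1 \<and> U n y = us"
              using uD(3) ur_us x by (intro IVT2' continuous_on_subset[OF uD(4)]) auto
            then obtain y where "x \<le> y" "y \<le> 1" "U n y = us" by blast
            then show False using away[of y] False x by simp
          qed
          then show ?thesis using udag_right(1)[of x] x False by simp
        qed
        moreover have "\<bar>f (U n x) - f (udag x)\<bar> < well_height (e / 2)"
          using b[OF x] elim m f_udag[OF x] by (simp add: m_def)
        ultimately have "\<bar>U n x - udag x\<bar> < e / 2" by (rule branch_close[OF half_gt_zero[OF e]])
        then show ?thesis using e by (simp add: dist_real_def)
      qed
    qed
  qed
qed

end

text \<open>Continuity is inherited from the uniform limit of a minimizing sequence, which spares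
  matching the two inverse branches at \<open>xdag\<close>.\<close>

lemma udag_continuous: "continuous_on {0..1} udag"
proof -
  obtain U where U: "\<And>n. U n \<in> admissible ul ur" "(\<lambda>n. J0 f (U n)) \<longlonglongrightarrow> 1 / 2 * s\<^sup>2"
    using minimizing_exists by blast
  show ?thesis
    by (rule uniform_limit_theorem[OF _ minimizing_uniform_limit[OF U]]) (use admissibleD(4)[OF U(1)] in auto)
qed

section \<open>The square-root singularity and the blow-up of derivatives\<close>

lemma f'_square_bound: "\<exists>M>0. \<forall>z\<in>{ur..us}. (f' z)\<^sup>2 \<le> 2 * M * f z"
proof -
  have "bounded (f'' ` {ur..us})"
    by (intro compact_imp_bounded compact_continuous_image continuous_on_subset[OF f_C2]) auto
  then obtain M where M: "\<forall>z\<in>{ur..us}. \<bar>f'' z\<bar> \<le> M" unfolding bounded_real by blast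
  have "M > 0" using M[rule_format, of us] f_convex[of us] ur_us by auto
  moreover have "(f' z)\<^sup>2 \<le> 2 * M * f z" if z: "z \<in> {ur..us}" for z
  proof -
    \<comment> \<open>The difference vanishes at \<open>us\<close> and has derivative
      \<open>2 * f' x * (M - f'' x)\<close>, which is nonpositive to the left of \<open>us\<close>.
      The bound expresses that \<open>f\<close> is at most quadratically sharp at its minimum:
      \<open>f'\<close> is of the order of the square root of \<open>f\<close>.\<close>
    have "2 * M * f us - (f' us)\<^sup>2 \<le> 2 * M * f z - (f' z)\<^sup>2"
    proof (rule DERIV_nonpos_imp_nonincreasing[of z us "\<lambda>x. 2 * M * f x - (f' x)\<^sup>2"])
      show "z \<le> us" using z by simp
      fix x assume x: "z \<le> x" "x \<le> us"
      have "((\<lambda>x. 2 * M * f x - (f' x)\<^sup>2) has_real_derivative 2 * f' x * (M - f'' x)) (at x)"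
        by (auto intro!: derivative_eq_intros f_deriv f_deriv2 simp: algebra_simps)
      moreover have "2 * f' x * (M - f'' x) \<le> 0"
        using f'_mono[OF x(2)] f'_us M[rule_format, of x] x z
        by (intro mult_nonpos_nonneg[of "2 * f' x"]) auto
      ultimately show "\<exists>y. ((\<lambda>x. 2 * M * f x - (f' x)\<^sup>2) has_real_derivative y) (at x) \<and> y \<le> 0" by blast
    qed
    then show ?thesis using f_us f'_us by simp
  qed
  ultimately show ?thesis by blast
qed

text \<open>Near \<open>xdag\<close> the profile \<open>udag\<close> behaves like a square root, so that each dyadic annulus
  around \<open>xdag\<close> contributes at least a fixed amount to the squared norm of the derivative.\<close>

definition dyadic :: "nat \<Rightarrow> real" where
  "dyadic k = xdag + (1 - xdag) * (1 / 2) ^ k"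

lemma dyadic: "dyadic (Suc k) < dyadic k" "xdag < dyadic k" "dyadic k \<le> 1" "dyadic 0 = 1"
proof -
  have p: "(1 - xdag) * (1 / 2) ^ k > 0" using xdag by simp
  then show "dyadic (Suc k) < dyadic k" "xdag < dyadic k" by (simp_all add: dyadic_def)
  have "(1 - xdag) * (1 / 2) ^ k \<le> (1 - xdag) * 1"
    using xdag by (intro mult_left_mono power_le_one) auto
  then show "dyadic k \<le> 1" by (simp add: dyadic_def)
  show "dyadic 0 = 1" by (simp add: dyadic_def)
qed

text \<open>Across one interval, of length \<open>h / s\<close>, the flux halves from
  \<open>2 * h\<close> to \<open>h\<close>, while the slope of \<open>f\<close> is at most
  \<open>sqrt (4 * M * h)\<close> in modulus. So \<open>udag\<close> changes by at least
  \<open>sqrt (h / (4 * M))\<close>, and squaring and dividing by the length eliminates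
  \<open>h\<close>.\<close>

lemma dyadic_contribution:
  assumes M: "M > 0" "\<forall>z\<in>{ur..us}. (f' z)\<^sup>2 \<le> 2 * M * f z"
  shows "s / (4 * M) \<le> (udag (dyadic k) - udag (dyadic (Suc k)))\<^sup>2 / (dyadic k - dyadic (Suc k))"
proof -
  define h where "h = s * ((1 - xdag) * (1 / 2) ^ Suc k)"
  define z where "z = udag (dyadic k)"
  define z' where "z' = udag (dyadic (Suc k))"
  have h: "h > 0" using s_pos xdag by (simp add: h_def)
  have "dyadic k - dyadic (Suc k) = (1 - xdag) * (1 / 2) ^ Suc k" by (simp add: dyadic_def field_simps)
  then have gap: "dyadic k - dyadic (Suc k) = h / s" using s_pos by (simp add: h_def)
  have fz: "f z = 2 * h" "f z' = h" and us: "z \<le> us" "z' \<le> us"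
    using udag_right[of "dyadic k"] udag_right[of "dyadic (Suc k)"] dyadic(1-3)[of k] dyadic(1-3)[of "Suc k"]
    by (auto simp: z_def z'_def h_def dyadic_def)
  have zz': "z < z'" using f_mono_left_le[of z' z] fz h us by force
  \<comment> \<open>Since \<open>2 * h\<close> is at most \<open>f ur\<close>, the point
    \<open>z\<close> stays in the range where the bound with \<open>M\<close> holds.\<close>
  have "h \<le> s * (1 - xdag) / 2"
    using s_pos xdag power_le_one[of "1 / 2 :: real" k] by (simp add: h_def mult_left_le)
  then have "ur \<le> z" using f_mono_left[of z ur] ur_us fz s_xdag(2) by force
  then have Mz: "(f' z)\<^sup>2 \<le> 4 * M * h" using M(2)[rule_format, of z] us fz by simp
  obtain \<xi> where xi: "z < \<xi>" "\<xi> < z'" "f z' - f z = (z' - z) * f' \<xi>"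
    using MVT2[OF zz', of f f'] f_deriv by blast
  have "h = (z' - z) * (- f' \<xi>)" using xi(3) fz by simp
  \<comment> \<open>To the left of \<open>us\<close> the slope of \<open>f\<close> is steepest at
    the outer end \<open>z\<close>.\<close>
  also have "\<dots> \<le> (z' - z) * (- f' z)" using f'_mono[of z \<xi>] xi zz' by (intro mult_left_mono) auto
  finally have "h\<^sup>2 \<le> ((z' - z) * (- f' z))\<^sup>2" using h by (intro power_mono) auto
  also have "\<dots> = (z' - z)\<^sup>2 * (f' z)\<^sup>2" by (simp add: power_mult_distrib)
  also have "\<dots> \<le> (z' - z)\<^sup>2 * (4 * M * h)" using Mz by (intro mult_left_mono) auto
  finally have "h * h \<le> (4 * M * (z' - z)\<^sup>2) * h" by (simp add: power2_eq_square algebra_simps)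
  then have "h \<le> 4 * M * (z' - z)\<^sup>2" using h by simp
  then have "s / (4 * M) \<le> (z' - z)\<^sup>2 / (h / s)" using M(1) h s_pos by (simp add: field_simps)
  then show ?thesis by (simp add: gap z_def z'_def power2_commute)
qed

lemma derivative_blowup:
  assumes V: "\<And>n. V n \<in> H1_cont"
    and lim: "\<And>x. 0 \<le> x \<Longrightarrow> x \<le> 1 \<Longrightarrow> (\<lambda>n. V n x) \<longlonglongrightarrow> udag x"
  shows "filterlim (\<lambda>n. l2norm (weak_deriv (V n))) at_top sequentially"
  unfolding filterlim_at_top
proof
  fix Z :: real
  obtain M where M: "M > 0" "\<forall>z\<in>{ur..us}. (f' z)\<^sup>2 \<le> 2 * M * f z" using f'_square_bound by blast
  define q where "q v k = (v (dyadic k) - v (dyadic (Suc k)))\<^sup>2 / (dyadic k - dyadic (Suc k))" for v :: "real \<Rightarrow> real" and k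
  have "s / (4 * M) > 0" using s_pos M by simp
  \<comment> \<open>Enough equal contributions are taken to exceed the square of \<open>Z\<close>.
    With \<open>K\<close> fixed only finitely many points are involved, so pointwise convergence
    suffices.\<close>
  then obtain K :: nat where K: "Z\<^sup>2 < real K * (s / (4 * M))" using reals_Archimedean3 by blast
  also have "real K * (s / (4 * M)) = (\<Sum>k<K. s / (4 * M))" by simp
  also have "\<dots> \<le> (\<Sum>k<K. q udag k)" unfolding q_def by (intro sum_mono dyadic_contribution M)
  finally have "Z\<^sup>2 < (\<Sum>k<K. q udag k)" .
  moreover have dyadic0: "0 \<le> dyadic k" for k using dyadic(2)[of k] xdag(1) by linarith
  have "(\<lambda>n. \<Sum>k<K. q (V n) k) \<longlonglongrightarrow> (\<Sum>k<K. q udag k)"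
    unfolding q_def
    by (intro tendsto_sum tendsto_divide tendsto_power tendsto_diff lim tendsto_const dyadic0 dyadic(3))
      (use dyadic(1) in \<open>simp add: less_imp_neq[THEN not_sym]\<close>)
  ultimately have "\<forall>\<^sub>F n in sequentially. Z\<^sup>2 < (\<Sum>k<K. q (V n) k)" by (intro order_tendstoD(1))
  then show "\<forall>\<^sub>F n in sequentially. Z \<le> l2norm (weak_deriv (V n))"
  proof eventually_elim
    case (elim n)
    have "(\<Sum>k<K. q (V n) k) \<le> (l2norm (weak_deriv (V n)))\<^sup>2"
      unfolding q_def by (intro H1_cont_sum_increments_le V dyadic dyadic0)
    then have "Z\<^sup>2 \<le> (l2norm (weak_deriv (V n)))\<^sup>2" using elim by linarith
    then show ?case by (rule power2_le_imp_le) simp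
  qed
qed

lemma minimizing_derivative_blowup:
  assumes "\<And>n. U n \<in> admissible ul ur" "(\<lambda>n. J0 f (U n)) \<longlonglongrightarrow> 1 / 2 * s\<^sup>2"
  shows "filterlim (\<lambda>n. l2norm (weak_deriv (U n))) at_top sequentially"
  by (rule derivative_blowup)
    (use admissibleD(1)[OF assms(1)] tendsto_uniform_limitI[OF minimizing_uniform_limit[OF assms]] in auto)

lemma udag_not_H1: "udag \<notin> H1"
proof
  assume "udag \<in> H1"
  then have "udag \<in> H1_cont" using udag_continuous by (simp add: H1_cont_def)
  then have "filterlim (\<lambda>n. l2norm (weak_deriv udag)) at_top sequentially" by (intro derivative_blowup) auto
  then show False using filterlim_at_top_dense by (fastforce simp: filterlim_at_top_dense)
qed

lemma not_attained: "u \<in> admissible ul ur \<Longrightarrow> J0 f u \<noteq> 1 / 2 * s\<^sup>2"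
proof
  assume u: "u \<in> admissible ul ur" and min: "J0 f u = 1 / 2 * s\<^sup>2"
  have "(\<lambda>n. J0 f u) \<longlonglongrightarrow> 1 / 2 * s\<^sup>2" unfolding min by (rule tendsto_const)
  then have "filterlim (\<lambda>n. l2norm (weak_deriv u)) at_top sequentially"
    by (rule minimizing_derivative_blowup[OF u])
  then show False by (fastforce simp: filterlim_at_top_dense)
qed

end

theorem theorem2:
  fixes f f' f'' :: "real \<Rightarrow> real" and us ul ur s xdag :: real
    and udag rdag :: "real \<Rightarrow> real"
  assumes f_deriv: "\<And>z. (f has_real_derivative f' z) (at z)"
    and f_deriv2: "\<And>z. (f' has_real_derivative f'' z) (at z)"
    and f_C2: "continuous_on UNIV f''"
    and f_convex: "\<And>z. f'' z > 0"
    and f_coercive: "filterlim f at_top at_infinity"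
    and us_min: "\<And>z. f us \<le> f z"
    and f_us: "f us = 0"
    and ur_us: "ur < us" and us_ul: "us < ul"
    and s_eq: "s = f ul + f ur"
    and xdag_eq: "xdag = f ul / s"
    and udag_eq: "udag = (\<lambda>x. if x \<le> xdag then inv_into {us..} f (s * \<bar>x - xdag\<bar>)
                                else inv_into {..us} f (s * \<bar>x - xdag\<bar>))"
    and rdag_eq: "rdag = (\<lambda>x. s * sgn (x - xdag))"
  shows
    "((INF u\<in>admissible ul ur. J0 f u) = 1 / 2 * s\<^sup>2 \<and>
      (\<forall>U. minimizing_seq f (admissible ul ur) U \<longrightarrow>
         uniform_limit {0..1} U udag sequentially \<and>
         (\<lambda>n. l2norm (\<lambda>x. weak_deriv (\<lambda>y. f (U n y)) x - rdag x)) \<longlonglongrightarrow> 0 \<and>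
         filterlim (\<lambda>n. l2norm (weak_deriv (U n))) at_top sequentially) \<and>
      continuous_on {0..1} udag \<and> udag \<notin> H1 \<and>
      rdag \<in> L2 \<and> rdag \<notin> H1 \<and>
      \<not> (\<exists>u\<in>admissible ul ur. J0 f u = (INF v\<in>admissible ul ur. J0 f v)))
     \<and>
     (\<forall>(w :: real ^ 'N \<Rightarrow> real \<Rightarrow> real) (\<theta> :: nat \<Rightarrow> real ^ 'N).
        (\<forall>p. w p \<in> admissible ul ur) \<longrightarrow>
        C1_family w \<longrightarrow>
        (\<forall>R>0. bdd_above ((\<lambda>p. l2norm (weak_deriv (w p))) ` {p. norm p \<le> R})) \<longrightarrow>
        (\<lambda>n. J0 f (w (\<theta> n))) \<longlonglongrightarrow> (INF u\<in>admissible ul ur. J0 f u) \<longrightarrow>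
        filterlim (\<lambda>n. norm (\<theta> n)) at_top sequentially)"
proof -
  interpret singular_minimization f f' f'' us ul ur s xdag udag
    by unfold_locales (fact f_deriv f_deriv2 f_C2 f_convex us_min f_us ur_us us_ul s_eq xdag_eq udag_eq)+
  have U: "uniform_limit {0..1} U udag sequentially \<and>
         (\<lambda>n. l2norm (\<lambda>x. weak_deriv (\<lambda>y. f (U n y)) x - rdag x)) \<longlonglongrightarrow> 0 \<and>
         filterlim (\<lambda>n. l2norm (weak_deriv (U n))) at_top sequentially"
    if "minimizing_seq f (admissible ul ur) U" for U
  proof -
    have m: "\<And>n. U n \<in> admissible ul ur" "(\<lambda>n. J0 f (U n)) \<longlonglongrightarrow> 1 / 2 * s\<^sup>2"
      using that unfolding minimizing_seq_def INF_J0 by blast+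
    show ?thesis unfolding rdag_eq
      by (intro conjI minimizing_uniform_limit flux_derivative_tendsto minimizing_derivative_blowup m)
  qed
  have escape: "filterlim (\<lambda>n. norm (\<theta> n)) at_top sequentially"
    if w: "\<And>p. w p \<in> admissible ul ur"
      and bdd: "\<And>R. R > 0 \<Longrightarrow> bdd_above ((\<lambda>p. l2norm (weak_deriv (w p))) ` {p. norm p \<le> R})"
      and lim: "(\<lambda>n. J0 f (w (\<theta> n))) \<longlonglongrightarrow> (INF u\<in>admissible ul ur. J0 f u)"
    for w :: "real ^ 'N \<Rightarrow> real \<Rightarrow> real" and \<theta>
    unfolding filterlim_at_top
  proof
    fix R :: real
    have blow: "filterlim (\<lambda>n. l2norm (weak_deriv (w (\<theta> n)))) at_top sequentially"
      using w lim[unfolded INF_J0] by (rule minimizing_derivative_blowup)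
    obtain B where B: "\<And>p. norm p \<le> max R 1 \<Longrightarrow> l2norm (weak_deriv (w p)) \<le> B"
    proof -
      \<comment> \<open>The bound is assumed for positive radii, whereas \<open>R\<close> here is
        arbitrary.\<close>
      have "max R 1 > 0" by simp
      then obtain B where "\<forall>x\<in>(\<lambda>p. l2norm (weak_deriv (w p))) ` {p. norm p \<le> max R 1}. x \<le> B"
        using bdd unfolding bdd_above_def by blast
      then show thesis by (intro that[of B]) blast
    qed
    \<comment> \<open>Once the derivative norm exceeds the bound \<open>B\<close> for the ball, the
      parameter must lie outside it.\<close>
    have "\<forall>\<^sub>F n in sequentially. B < l2norm (weak_deriv (w (\<theta> n)))"
      using blow unfolding filterlim_at_top_dense by blast
    then show "\<forall>\<^sub>F n in sequentially. R \<le> norm (\<theta> n)"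
    proof eventually_elim
      case (elim n)
      then show ?case using B[of "\<theta> n"] by linarith
    qed
  qed
  have rdag: "rdag \<in> L2" "rdag \<notin> H1"
    unfolding rdag_eq by (rule L2_sgn sgn_not_H1[OF xdag s_pos])+
  have not_att: "\<not> (\<exists>u\<in>admissible ul ur. J0 f u = (INF v\<in>admissible ul ur. J0 f v))"
    using not_attained unfolding INF_J0 by blast
  show ?thesis
    by (intro conjI allI impI INF_J0 U[THEN conjunct1] U[THEN conjunct2, THEN conjunct1]
        U[THEN conjunct2, THEN conjunct2] udag_continuous udag_not_H1 rdag not_att escape) auto
qed

end
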